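(* There is a sequence $(\eta_d)_{d\ge 1}$ of real numbers with $\eta_d\to 0$ as $d\to\infty$ such that the following holds for every dimension $d\geq 1$. Let $K\subseteq\mathbb R^d$ be a convex body and let $f\geq 1$ be an integer. Then there is an arrangement of translates of $K$ with density at most $$(1+\eta_d)\cdot 3.153\,\max\{d\ln d,\ f\},$$ such that every point of $\mathbb R^d$ is covered at least $f$ times (that is, belongs to at least $f$ members of the arrangement, counted with multiplicity).
   Context: A convex body is a compact convex set with nonempty interior. An arrangement of translates of $K$ is a family $\{K+x_i\}_{i\in I}$ with $x_i\in\mathbb R^d$ (repetitions allowed). Its (upper) density is $$\limsup_{r\to\infty}\frac{1}{\operatorname{vol}([-r,r]^d)}\sum_{i\in I:\ (K+x_i)\cap[-r,r]^d\neq\emptyset}\operatorname{vol}(K+x_i).$$ *)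

theory Defs
  imports "HOL-Analysis.Analysis"
begin

text \<open>
  The dimension \<open>d\<close> is quantified inside the theorem, so it cannot be a type. Points of
  \<open>\<real>\<^sup>d\<close> are therefore extensional functions on \<open>{..<d}\<close>; this set is the
  carrier both of the product topology and of the product measure below.
\<close>

definition Rd :: "nat \<Rightarrow> (nat \<Rightarrow> real) set" where
  "Rd d = (\<Pi>\<^sub>E i\<in>{..<d}. UNIV)"

definition Rd_topology :: "nat \<Rightarrow> (nat \<Rightarrow> real) topology" where
  "Rd_topology d = product_topology (\<lambda>_. euclideanreal) {..<d}"

definition vol :: "nat \<Rightarrow> (nat \<Rightarrow> real) set \<Rightarrow> ennreal" where
  "vol d A = emeasure (\<Pi>\<^sub>M i\<in>{..<d}. lborel) A"

definition Rd_convex :: "nat \<Rightarrow> (nat \<Rightarrow> real) set \<Rightarrow> bool" where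
  "Rd_convex d K \<longleftrightarrow>
     (\<forall>x\<in>K. \<forall>y\<in>K. \<forall>u\<ge>0. \<forall>v\<ge>0. u + v = 1 \<longrightarrow> (\<lambda>i\<in>{..<d}. u * x i + v * y i) \<in> K)"

definition convex_body :: "nat \<Rightarrow> (nat \<Rightarrow> real) set \<Rightarrow> bool" where
  "convex_body d K \<longleftrightarrow>
     compactin (Rd_topology d) K \<and> Rd_convex d K \<and> (Rd_topology d) interior_of K \<noteq> {}"

definition translate :: "nat \<Rightarrow> (nat \<Rightarrow> real) set \<Rightarrow> (nat \<Rightarrow> real) \<Rightarrow> (nat \<Rightarrow> real) set" where
  "translate d K v = (\<lambda>y. \<lambda>i\<in>{..<d}. y i + v i) ` K"

definition cube :: "nat \<Rightarrow> real \<Rightarrow> (nat \<Rightarrow> real) set" where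
  "cube d r = (\<Pi>\<^sub>E i\<in>{..<d}. {-r..r})"

text \<open>
  The sum is taken in \<^typ>\<open>ennreal\<close>, so it is \<open>\<infinity>\<close> whenever infinitely many translates
  of a convex body meet the cube.
\<close>

definition arrangement_density ::
  "nat \<Rightarrow> (nat \<Rightarrow> real) set \<Rightarrow> 'i set \<Rightarrow> ('i \<Rightarrow> nat \<Rightarrow> real) \<Rightarrow> ennreal" where
  "arrangement_density d K I x =
     Limsup at_top (\<lambda>r::real.
       (\<Sum>\<^sub>\<infinity>i\<in>{i\<in>I. translate d K (x i) \<inter> cube d r \<noteq> {}}. vol d (translate d K (x i)))
         / vol d (cube d r))"

definition covered_at_least ::
  "nat \<Rightarrow> (nat \<Rightarrow> real) set \<Rightarrow> 'i set \<Rightarrow> ('i \<Rightarrow> nat \<Rightarrow> real) \<Rightarrow> nat \<Rightarrow> (nat \<Rightarrow> real) \<Rightarrow> bool" where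
  "covered_at_least d K I x f p \<longleftrightarrow>
     infinite {i\<in>I. p \<in> translate d K (x i)} \<or> f \<le> card {i\<in>I. p \<in> translate d K (x i)}"

end

theory Submission
  imports Defs "HOL-Real_Asymp.Real_Asymp"
begin

text \<open>
  Let \<open>M = max (d ln d) f\<close> and \<open>c = 3.153\<close>. In a large cube, choose translates of \<open>A = (1 - \<delta>) K\<close>
  of total density about \<open>c M\<close> one after the other, each time at a point where
  \<open>\<integral> (1/c)\<^bsup>(multiplicity at z)\<^esup> dz\<close> is at most its average. This derandomised Chernoff bound shows that
  the set \<open>B\<close> of points covered fewer than \<open>f\<close> times has relative volume at most
  \<open>exp (- (c - 1 - ln c) M)\<close>, and \<open>c\<close> is such that \<open>c - 1 - ln c > 1\<close>.

  If some point of \<open>p - \<delta> K\<close> lies outside \<open>B\<close>, then \<open>p\<close> is covered \<open>f\<close> times once the translates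
  of \<open>A\<close> are replaced by translates of \<open>K\<close>. Otherwise \<open>p - \<delta> K \<subseteq> B\<close>, and such points are covered by
  \<open>f\<close> copies of translates of \<open>K\<close> attached to a maximal packing of \<open>B\<close> by translates of \<open>- \<delta> L\<close>, where
  \<open>L = K \<inter> (w - K)\<close> has volume at least \<open>2\<^bsup>-d\<^esup> vol K\<close>. With \<open>\<delta>\<close> about \<open>1 / (d ln d)\<close> the first step
  loses only a factor \<open>(1 - \<delta>)\<^bsup>-d\<^esup> \<rightarrow> 1\<close>, and the density of the second family,
  at most \<open>f (2/\<delta>)\<^bsup>d\<^esup> exp (- (c - 1 - ln c) M)\<close>, is negligible. Periodic repetition of the cube gives
  the arrangement.
\<close>

subsection \<open>Lebesgue measure on extensional functions\<close>

abbreviation Leb :: "nat \<Rightarrow> (nat \<Rightarrow> real) measure" where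
  "Leb d \<equiv> Pi\<^sub>M {..<d} (\<lambda>_. lborel)"

lemma space_Leb: "space (Leb d) = Rd d"
  by (simp add: space_PiM Rd_def)

text \<open>The restriction is needed because \<open>undefined - undefined\<close> need not be
  \<open>undefined\<close>, so pointwise subtraction could leave \<open>Rd d\<close>.\<close>

definition diff :: "nat \<Rightarrow> (nat \<Rightarrow> real) \<Rightarrow> (nat \<Rightarrow> real) \<Rightarrow> nat \<Rightarrow> real" where
  "diff d x y = (\<lambda>i\<in>{..<d}. x i - y i)"

lemma diff_in_Rd [simp]: "diff d x y \<in> Rd d"
  by (auto simp: diff_def Rd_def)

lemma measurable_affine:
  "(\<lambda>x. \<lambda>i\<in>{..<d}. c * x i + v i) \<in> Leb d \<rightarrow>\<^sub>M Leb d"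
  by (intro measurable_restrict) (auto intro!: measurable_component_singleton borel_measurable_add borel_measurable_times)

lemma emeasure_lborel_affine_preimage:
  fixes c t :: real
  assumes "c \<noteq> 0" "A \<in> sets borel"
  shows "ennreal \<bar>c\<bar> * emeasure lborel {x. c * x + t \<in> A} = emeasure lborel A"
proof -
  have "emeasure lborel A = emeasure (density (distr lborel borel (\<lambda>x. t + c * x)) (\<lambda>_. ennreal \<bar>c\<bar>)) A"
    by (rule arg_cong[OF lborel_real_affine[OF assms(1), of t], of "\<lambda>M. emeasure M A"])
  also have "\<dots> = ennreal \<bar>c\<bar> * emeasure (distr lborel borel (\<lambda>x. t + c * x)) A"
    using assms(2) by (subst emeasure_density) (auto simp: nn_integral_cmult_indicator)
  also have "emeasure (distr lborel borel (\<lambda>x. t + c * x)) A = emeasure lborel {x. c * x + t \<in> A}"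
    using assms(2) by (subst emeasure_distr) (auto simp: vimage_def add.commute)
  finally show ?thesis by simp
qed

text \<open>The pushforward of \<open>Leb d\<close> under the affine map, scaled by
  \<open>\<bar>c\<bar> ^ d\<close>, agrees with \<open>Leb d\<close> on boxes, where it splits into
  one-dimensional factors. Uniqueness of the product measure extends this to all measurable
  sets.\<close>

lemma vol_affine_preimage:
  assumes c: "c \<noteq> 0" and A: "A \<in> sets (Leb d)"
  shows "ennreal (\<bar>c\<bar> ^ d) * vol d {x \<in> Rd d. (\<lambda>i\<in>{..<d}. c * x i + v i) \<in> A} = vol d A"
proof -
  interpret product_sigma_finite "\<lambda>_::nat. lborel :: real measure" ..
  let ?P = "Leb d"
  let ?T = "\<lambda>x. \<lambda>i\<in>{..<d}. c * x i + v i"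
  let ?N = "scale_measure (ennreal (\<bar>c\<bar> ^ d)) (distr ?P ?P ?T)"
  have "?N = ?P"
  proof (rule PiM_eqI)
    show "finite {..<d}" by simp
    show "sets ?N = sets ?P" by simp
    fix B :: "nat \<Rightarrow> real set" assume B: "\<And>i. i \<in> {..<d} \<Longrightarrow> B i \<in> sets lborel"
    have S: "{x. c * x + v i \<in> B i} \<in> sets lborel" if "i < d" for i
    proof -
      have "(\<lambda>x. c * x + v i) \<in> borel \<rightarrow>\<^sub>M borel" by simp
      from measurable_sets_borel[OF this, of "B i"] B[of i] that
      have "(\<lambda>x. c * x + v i) -` B i \<in> sets lborel" by simp
      then show ?thesis by (simp add: vimage_def)
    qed
    have eq: "?T -` Pi\<^sub>E {..<d} B \<inter> space ?P = Pi\<^sub>E {..<d} (\<lambda>i. {x. c * x + v i \<in> B i})"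
      unfolding space_PiM PiE_iff set_eq_iff Int_iff vimage_eq restrict_PiE_iff by auto
    have "emeasure ?N (Pi\<^sub>E {..<d} B) = ennreal (\<bar>c\<bar> ^ d) * emeasure ?P (Pi\<^sub>E {..<d} (\<lambda>i. {x. c * x + v i \<in> B i}))"
      using B by (subst emeasure_scale_measure, subst emeasure_distr)
        (auto simp: eq measurable_affine intro!: sets_PiM_I_finite)
    also have "\<dots> = ennreal (\<bar>c\<bar> ^ d) * (\<Prod>i<d. emeasure lborel {x. c * x + v i \<in> B i})"
      using S by (subst emeasure_PiM) auto
    also have "\<dots> = (\<Prod>i<d. ennreal \<bar>c\<bar> * emeasure lborel {x. c * x + v i \<in> B i})"
      by (simp add: prod.distrib ennreal_power)
    also have "\<dots> = (\<Prod>i<d. emeasure lborel (B i))"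
      using B c by (intro prod.cong refl emeasure_lborel_affine_preimage) auto
    finally show "emeasure ?N (Pi\<^sub>E {..<d} B) = (\<Prod>i<d. emeasure lborel (B i))" .
  qed
  then have "vol d A = emeasure ?N A" by (simp add: vol_def)
  also have "\<dots> = ennreal (\<bar>c\<bar> ^ d) * emeasure ?P (?T -` A \<inter> space ?P)"
    using A by (subst emeasure_scale_measure, subst emeasure_distr) (auto simp: measurable_affine)
  also have "?T -` A \<inter> space ?P = {x \<in> Rd d. ?T x \<in> A}"
    by (auto simp: space_PiM Rd_def)
  finally show ?thesis by (simp add: vol_def)
qed

lemma sets_affine_preimage:
  assumes "A \<in> sets (Leb d)"
  shows "{x \<in> Rd d. (\<lambda>i\<in>{..<d}. c * x i + v i) \<in> A} \<in> sets (Leb d)"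
proof -
  have "{x \<in> Rd d. (\<lambda>i\<in>{..<d}. c * x i + v i) \<in> A}
      = (\<lambda>x. \<lambda>i\<in>{..<d}. c * x i + v i) -` A \<inter> space (Leb d)"
    by (auto simp: space_PiM Rd_def)
  then show ?thesis using measurable_sets[OF measurable_affine assms] by simp
qed

lemma diff_left: "diff d z = (\<lambda>x. \<lambda>i\<in>{..<d}. (-1) * x i + z i)"
  by (auto simp: diff_def)

lemma diff_right_eq: "diff d z x = (\<lambda>i\<in>{..<d}. 1 * z i + (- x i))"
  by (auto simp: diff_def)

lemma vol_reflect:
  assumes "A \<in> sets (Leb d)"
  shows "vol d {x \<in> Rd d. diff d z x \<in> A} = vol d A"
    and "{x \<in> Rd d. diff d z x \<in> A} \<in> sets (Leb d)"
  using vol_affine_preimage[of "-1", OF _ assms, of z] sets_affine_preimage[OF assms, of "-1" z]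
  unfolding diff_left by auto

lemma vol_shift:
  assumes "A \<in> sets (Leb d)"
  shows "vol d {z \<in> Rd d. diff d z x \<in> A} = vol d A"
    and "{z \<in> Rd d. diff d z x \<in> A} \<in> sets (Leb d)"
  using vol_affine_preimage[of 1, OF _ assms, of "\<lambda>i. - x i"] sets_affine_preimage[OF assms, of 1 "\<lambda>i. - x i"]
  unfolding diff_right_eq by auto

section \<open>Translates, compact sets and cubes as sets of extensional functions\<close>

lemma translate_eq:
  assumes "K \<subseteq> Rd d"
  shows "translate d K v = {z \<in> Rd d. diff d z v \<in> K}"
proof (intro set_eqI iffI)
  fix z assume "z \<in> translate d K v"
  then obtain y where y: "y \<in> K" "z = (\<lambda>i\<in>{..<d}. y i + v i)" by (auto simp: translate_def)
  have "diff d z v = y" using y assms by (auto simp: diff_def Rd_def PiE_iff extensional_def fun_eq_iff subset_iff)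
  then show "z \<in> {z \<in> Rd d. diff d z v \<in> K}" using y by (auto simp: Rd_def)
next
  fix z assume "z \<in> {z \<in> Rd d. diff d z v \<in> K}"
  then have z: "z \<in> Rd d" "diff d z v \<in> K" by auto
  have "z = (\<lambda>i\<in>{..<d}. diff d z v i + v i)"
    using z(1) by (auto simp: diff_def Rd_def PiE_iff extensional_def fun_eq_iff)
  then show "z \<in> translate d K v" using z(2) by (auto simp: translate_def)
qed

text \<open>The inclusion of \<open>Rd d\<close> into the space of all functions is continuous: a
  coordinate is a projection below \<open>d\<close> and constantly \<open>undefined\<close> from
  \<open>d\<close> on. This makes the type class notion of compactness available.\<close>

lemma compact_if_compactin_Rd:
  assumes "compactin (Rd_topology d) K"
  shows "compact K" "K \<subseteq> Rd d"
proof -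
  show sub: "K \<subseteq> Rd d" using compactin_subset_topspace[OF assms] by (simp add: Rd_topology_def Rd_def)
  have "continuous_map (Rd_topology d) (product_topology (\<lambda>_::nat. euclideanreal) UNIV) (\<lambda>x. x)"
    unfolding continuous_map_componentwise_UNIV
  proof
    fix k :: nat
    show "continuous_map (Rd_topology d) euclideanreal (\<lambda>x. x k)"
    proof (cases "k < d")
      case True
      then show ?thesis unfolding Rd_topology_def by (intro continuous_map_product_projection) auto
    next
      case False
      have "continuous_map (Rd_topology d) euclideanreal (\<lambda>x. undefined)" by simp
      then show ?thesis
        by (rule continuous_map_eq) (use False in \<open>auto simp: Rd_topology_def PiE_iff extensional_def\<close>)
    qed
  qed
  from image_compactin[OF assms this] show "compact K"
    by (simp add: euclidean_product_topology)
qed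

lemma compact_measurable:
  assumes "compact K" "K \<subseteq> Rd d"
  shows "K \<in> sets (Leb d)"
proof -
  \<comment> \<open>Compact sets are closed, hence Borel in the full function space; measurability
    of the inclusion brings this back to \<open>Leb d\<close>.\<close>
  have "(\<lambda>x. x) \<in> Leb d \<rightarrow>\<^sub>M (borel :: (nat \<Rightarrow> real) measure)"
  proof (rule measurable_coordinatewise_then_product)
    fix k :: nat
    show "(\<lambda>x. x k) \<in> Leb d \<rightarrow>\<^sub>M borel"
    proof (cases "k < d")
      case True
      then have "(\<lambda>x. x k) \<in> Leb d \<rightarrow>\<^sub>M lborel"
        by (intro measurable_component_singleton) auto
      then show ?thesis by simp
    next
      case False
      have "(\<lambda>x. undefined) \<in> Leb d \<rightarrow>\<^sub>M (borel::real measure)" by simp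
      then show ?thesis
        by (rule measurable_cong[THEN iffD2, rotated]) (use False in \<open>auto simp: space_PiM PiE_iff extensional_def\<close>)
    qed
  qed
  from measurable_sets[OF this borel_closed[OF compact_imp_closed[OF assms(1)]]]
  show ?thesis using assms(2) by (simp add: space_PiM Rd_def Int_absorb2)
qed

lemma compact_subset_cube:
  assumes "compact K" "K \<subseteq> Rd d"
  obtains \<rho> where "\<rho> > 0" "K \<subseteq> cube d \<rho>"
proof -
  have "\<exists>b. \<forall>x\<in>K. \<bar>x i\<bar> \<le> b" for i
  proof -
    have "compact ((\<lambda>x. x i) ` K)"
      using assms(1) by (intro compact_continuous_image continuous_on_subset[OF continuous_on_product_coordinates]) auto
    then have "bounded ((\<lambda>x. x i) ` K)" by (rule compact_imp_bounded)
    then show ?thesis by (auto simp: bounded_iff)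
  qed
  then obtain b where b: "\<And>i x. x \<in> K \<Longrightarrow> \<bar>x i\<bar> \<le> b i" by metis
  let ?r = "1 + (\<Sum>i<d. \<bar>b i\<bar>)"
  have "\<bar>x i\<bar> \<le> ?r" if "x \<in> K" "i < d" for x i
  proof -
    have "\<bar>x i\<bar> \<le> \<bar>b i\<bar>" using b[OF that(1), of i] by linarith
    also have "\<dots> \<le> (\<Sum>i<d. \<bar>b i\<bar>)" using that(2) by (intro member_le_sum) auto
    finally show ?thesis by simp
  qed
  then have "K \<subseteq> cube d ?r"
    using assms(2) by (fastforce simp: cube_def Rd_def PiE_iff abs_le_iff)
  moreover have "?r > 0" by (simp add: add_pos_nonneg sum_nonneg)
  ultimately show ?thesis using that by blast
qed

lemma mem_cube_iff: "x \<in> cube d r \<longleftrightarrow> x \<in> Rd d \<and> (\<forall>i<d. \<bar>x i\<bar> \<le> r)"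
  by (auto simp: cube_def Rd_def PiE_iff abs_le_iff minus_le_iff)

lemma sets_cube: "cube d r \<in> sets (Leb d)"
  unfolding cube_def by (intro sets_PiM_I_finite) auto

lemma vol_cube: "r \<ge> 0 \<Longrightarrow> vol d (cube d r) = ennreal ((2 * r) ^ d)"
proof -
  assume r: "r \<ge> 0"
  interpret product_sigma_finite "\<lambda>_::nat. lborel :: real measure" ..
  have "vol d (cube d r) = (\<Prod>i<d. emeasure lborel {-r..r})"
    unfolding vol_def cube_def by (subst emeasure_PiM) auto
  also have "\<dots> = ennreal ((2 * r) ^ d)" using r by (simp add: ennreal_power)
  finally show ?thesis .
qed

text \<open>An interior point has a box neighbourhood inside \<open>K\<close>, and nonempty open
  sides have positive length.\<close>

lemma vol_pos_of_interior:
  assumes "(Rd_topology d) interior_of K \<noteq> {}" and K: "K \<in> sets (Leb d)"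
  shows "vol d K > 0"
proof -
  interpret product_sigma_finite "\<lambda>_::nat. lborel :: real measure" ..
  obtain x where x: "x \<in> (Rd_topology d) interior_of K" using assms by auto
  have "openin (product_topology (\<lambda>_. euclideanreal) {..<d}) ((Rd_topology d) interior_of K)"
    unfolding Rd_topology_def by simp
  then have "\<exists>U. finite {i \<in> {..<d}. U i \<noteq> topspace euclideanreal} \<and> (\<forall>i\<in>{..<d}. openin euclideanreal (U i))
      \<and> x \<in> Pi\<^sub>E {..<d} U \<and> Pi\<^sub>E {..<d} U \<subseteq> (Rd_topology d) interior_of K"
    using x unfolding openin_product_topology_alt by meson
  then obtain U where U: "\<And>i. i < d \<Longrightarrow> open (U i)" "x \<in> Pi\<^sub>E {..<d} U" "Pi\<^sub>E {..<d} U \<subseteq> (Rd_topology d) interior_of K"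
    by auto
  have "emeasure lborel (U i) > 0" if "i < d" for i
  proof -
    have "x i \<in> U i" using U(2) that by auto
    then have "U i \<noteq> {}" by auto
    then have "U i \<notin> null_sets lborel"
      using U(1)[OF that] open_not_negligible[of "U i"] null_sets_completionI[of "U i" lborel]
      by (auto simp: negligible_iff_null_sets)
    then show ?thesis using U(1)[OF that] by (auto simp: null_sets_def zero_less_iff_neq_zero)
  qed
  then have "(\<Prod>i<d. emeasure lborel (U i)) > 0"
    by (simp add: zero_less_iff_neq_zero prod_zero_iff)
  also have "(\<Prod>i<d. emeasure lborel (U i)) = vol d (Pi\<^sub>E {..<d} U)"
    unfolding vol_def using U(1) by (subst emeasure_PiM) auto
  also have "\<dots> \<le> vol d K" unfolding vol_def
    using U(3) interior_of_subset[of "Rd_topology d" K] K by (intro emeasure_mono) auto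
  finally show ?thesis .
qed

subsection \<open>Averaging arguments\<close>

lemma sigma_finite_Leb: "sigma_finite_measure (Leb d)"
proof -
  interpret product_sigma_finite "\<lambda>_::nat. lborel :: real measure" ..
  show ?thesis by (rule sigma_finite) simp
qed

lemma measurable_diff_pair:
  "(\<lambda>p. diff d (snd p) (fst p)) \<in> (Leb d \<Otimes>\<^sub>M Leb d) \<rightarrow>\<^sub>M Leb d"
proof -
  have c: "(\<lambda>x. x i) \<in> Leb d \<rightarrow>\<^sub>M borel" if "i < d" for i
    using measurable_component_singleton[of i "{..<d}" "\<lambda>_. lborel::real measure"] that by simp
  have "(\<lambda>p. snd p i - fst p i) \<in> (Leb d \<Otimes>\<^sub>M Leb d) \<rightarrow>\<^sub>M lborel" if "i < d" for i
    using measurable_compose[OF measurable_snd c[OF that], of "Leb d" ] measurable_compose[OF measurable_fst c[OF that], of "Leb d"]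
    by simp
  then show ?thesis unfolding diff_def by (intro measurable_restrict) auto
qed

text \<open>If \<open>F\<close> exceeded \<open>r\<close> throughout the non-null set
  \<open>S\<close>, the integral would be strictly larger than \<open>r * emeasure M S\<close>;
  strictness relies on that product being finite.\<close>

lemma exists_le_average:
  fixes F :: "'a \<Rightarrow> ennreal"
  assumes F: "F \<in> borel_measurable M" and S: "S \<in> sets M"
    and fin: "emeasure M S \<noteq> 0" "emeasure M S \<noteq> \<infinity>" "r \<noteq> \<infinity>"
    and le: "(\<integral>\<^sup>+x\<in>S. F x \<partial>M) \<le> r * emeasure M S"
  shows "\<exists>x\<in>S. F x \<le> r"
proof (rule ccontr)
  assume "\<not> ?thesis"
  then have gt: "\<And>x. x \<in> S \<Longrightarrow> r < F x" by (auto simp: not_le)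
  have "(\<integral>\<^sup>+x\<in>S. r \<partial>M) < (\<integral>\<^sup>+x\<in>S. F x \<partial>M)"
  proof (rule nn_integral_less)
    show "(\<integral>\<^sup>+x\<in>S. r \<partial>M) \<noteq> \<infinity>" using S fin by (simp add: nn_integral_cmult_indicator ennreal_mult_eq_top_iff)
    show "AE x in M. r * indicator S x \<le> F x * indicator S x"
      using gt by (auto simp: indicator_def less_imp_le)
    show "\<not> (AE x in M. F x * indicator S x \<le> r * indicator S x)"
    proof
      assume "AE x in M. F x * indicator S x \<le> r * indicator S x"
      then have "AE x in M. x \<notin> S" using gt by (elim AE_mp) (auto simp: indicator_def not_le[symmetric])
      then show False using S fin(1) by (subst (asm) AE_iff_null_sets[symmetric]) (auto simp: null_sets_def)
    qed
  qed (use F S in auto)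
  then show False using le S by (simp add: nn_integral_cmult_indicator not_less[symmetric])
qed

lemma exists_ge_average:
  fixes F :: "'a \<Rightarrow> ennreal"
  assumes F: "F \<in> borel_measurable M" and S: "S \<in> sets M"
    and fin: "emeasure M S \<noteq> 0" "(\<integral>\<^sup>+x\<in>S. F x \<partial>M) \<noteq> \<infinity>"
    and le: "r * emeasure M S \<le> (\<integral>\<^sup>+x\<in>S. F x \<partial>M)"
  shows "\<exists>x\<in>S. r \<le> F x"
proof (rule ccontr)
  assume "\<not> ?thesis"
  then have gt: "\<And>x. x \<in> S \<Longrightarrow> F x < r" by (auto simp: not_le)
  have "(\<integral>\<^sup>+x\<in>S. F x \<partial>M) < (\<integral>\<^sup>+x\<in>S. r \<partial>M)"
  proof (rule nn_integral_less)
    show "AE x in M. F x * indicator S x \<le> r * indicator S x"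
      using gt by (auto simp: indicator_def less_imp_le)
    show "\<not> (AE x in M. r * indicator S x \<le> F x * indicator S x)"
    proof
      assume "AE x in M. r * indicator S x \<le> F x * indicator S x"
      then have "AE x in M. x \<notin> S" using gt by (elim AE_mp) (auto simp: indicator_def not_le[symmetric])
      then show False using S fin(1) by (subst (asm) AE_iff_null_sets[symmetric]) (auto simp: null_sets_def)
    qed
  qed (use F S fin in auto)
  then show False using le S by (simp add: nn_integral_cmult_indicator not_less[symmetric])
qed

text \<open>Fubini gives the mean of the new integral over \<open>x \<in> Q2\<close>. For fixed
  \<open>z \<in> Q1\<close>, the \<open>x\<close> with \<open>diff d z x \<in> A\<close> form a
  reflected copy of \<open>A\<close>, which \<open>cov\<close> places inside \<open>Q2\<close>; so
  the mean of the factor is \<open>1 - (1 - s) * a / V2\<close> whatever \<open>z\<close> is. Some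
  \<open>x\<close> does at least as well as the mean.\<close>

lemma averaging_step:
  fixes s a V2 :: real and w :: "(nat \<Rightarrow> real) \<Rightarrow> ennreal"
  assumes sets: "Q1 \<in> sets (Leb d)" "Q2 \<in> sets (Leb d)" "A \<in> sets (Leb d)"
    and V2: "vol d Q2 = ennreal V2" "V2 > 0" and a: "vol d A = ennreal a" "a \<ge> 0"
    and s: "0 \<le> s" "s \<le> 1"
    and cov: "\<forall>z\<in>Q1. \<forall>x\<in>Rd d. diff d z x \<in> A \<longrightarrow> x \<in> Q2"
    and w: "w \<in> borel_measurable (Leb d)" "(\<integral>\<^sup>+z\<in>Q1. w z \<partial>Leb d) \<noteq> \<infinity>"
  shows "\<exists>x\<in>Q2. (\<integral>\<^sup>+z\<in>Q1. w z * (if diff d z x \<in> A then ennreal s else 1) \<partial>Leb d)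
           \<le> ennreal (1 - (1 - s) * a / V2) * (\<integral>\<^sup>+z\<in>Q1. w z \<partial>Leb d)"
proof -
  interpret L: sigma_finite_measure "Leb d" by (rule sigma_finite_Leb)
  interpret LL: pair_sigma_finite "Leb d" "Leb d" ..
  let ?\<sigma> = "\<lambda>z x. (if diff d z x \<in> A then ennreal s else 1)"
  let ?G = "\<lambda>p. w (snd p) * ?\<sigma> (snd p) (fst p) * indicator Q1 (snd p)"
  have \<sigma>: "(\<lambda>p. ?\<sigma> (snd p) (fst p)) \<in> borel_measurable (Leb d \<Otimes>\<^sub>M Leb d)"
    using measurable_sets[OF measurable_diff_pair sets(3)]
    by (intro measurable_If measurable_const) (simp_all add: vimage_def Int_def conj_commute)
  have G: "?G \<in> borel_measurable (Leb d \<Otimes>\<^sub>M Leb d)"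
    using \<sigma> w(1) sets(1) by (intro borel_measurable_times_ennreal) (auto intro: measurable_compose[OF measurable_snd])
  have inner: "(\<integral>\<^sup>+x\<in>Q2. ?\<sigma> z x \<partial>Leb d) = ennreal (1 - (1 - s) * a / V2) * ennreal V2" if z: "z \<in> Q1" for z
  proof -
    let ?S = "{x \<in> Rd d. diff d z x \<in> A}"
    have S: "?S \<in> sets (Leb d)" "?S \<subseteq> Q2" "vol d ?S = ennreal a"
      using vol_reflect[OF sets(3), of z] cov z a by auto
    have Q2: "Q2 \<subseteq> Rd d" using sets.sets_into_space[OF sets(2)] by (simp add: space_Leb)
    have le: "a \<le> V2"
    proof -
      have "vol d ?S \<le> vol d Q2" unfolding vol_def using S sets by (intro emeasure_mono) auto
      then show ?thesis using S V2 by simp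
    qed
    have "(\<integral>\<^sup>+x\<in>Q2. ?\<sigma> z x \<partial>Leb d) = (\<integral>\<^sup>+x. ennreal s * indicator ?S x + indicator (Q2 - ?S) x \<partial>Leb d)"
      using S(2) Q2 by (intro nn_integral_cong) (auto simp: indicator_def)
    also have "\<dots> = ennreal s * emeasure (Leb d) ?S + emeasure (Leb d) (Q2 - ?S)"
      using S(1) sets by (subst nn_integral_add) (auto simp: nn_integral_cmult_indicator)
    also have "emeasure (Leb d) (Q2 - ?S) = ennreal V2 - ennreal a"
      using S sets V2 by (subst emeasure_Diff) (auto simp: vol_def)
    also have "ennreal s * emeasure (Leb d) ?S + (ennreal V2 - ennreal a) = ennreal (s * a + (V2 - a))"
      using S a s le V2 by (simp add: vol_def ennreal_mult ennreal_minus ennreal_plus)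
    also have "s * a + (V2 - a) = (1 - (1 - s) * a / V2) * V2" using V2 by (simp add: field_simps)
    also have "ennreal \<dots> = ennreal (1 - (1 - s) * a / V2) * ennreal V2"
      using V2 by (simp add: ennreal_mult'')
    finally show ?thesis .
  qed
  let ?F = "\<lambda>x. \<integral>\<^sup>+z. w z * ?\<sigma> z x * indicator Q1 z \<partial>Leb d"
  have F: "?F \<in> borel_measurable (Leb d)"
    using L.borel_measurable_nn_integral_fst[OF G] by simp
  have "(\<integral>\<^sup>+x\<in>Q2. ?F x \<partial>Leb d) = (\<integral>\<^sup>+x. \<integral>\<^sup>+z. ?G (x, z) * indicator Q2 x \<partial>Leb d \<partial>Leb d)"
    using measurable_compose[OF measurable_Pair1' G]
    by (intro nn_integral_cong) (auto intro!: nn_integral_multc[symmetric])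
  also have "\<dots> = (\<integral>\<^sup>+z. \<integral>\<^sup>+x. ?G (x, z) * indicator Q2 x \<partial>Leb d \<partial>Leb d)"
    using G sets(2) by (intro LL.Fubini'[symmetric])
      (auto simp: case_prod_beta intro!: borel_measurable_times_ennreal measurable_compose[OF measurable_fst])
  also have "\<dots> = (\<integral>\<^sup>+z. (w z * indicator Q1 z) * (\<integral>\<^sup>+x\<in>Q2. ?\<sigma> z x \<partial>Leb d) \<partial>Leb d)"
  proof (intro nn_integral_cong)
    fix z assume z: "z \<in> space (Leb d)"
    have "(\<lambda>x. ?\<sigma> z x * indicator Q2 x) \<in> borel_measurable (Leb d)"
      using measurable_compose[OF measurable_Pair2'[OF z] \<sigma>] sets(2) by simp
    from nn_integral_cmult[OF this, of "w z * indicator Q1 z"]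
    show "(\<integral>\<^sup>+x. ?G (x, z) * indicator Q2 x \<partial>Leb d) = (w z * indicator Q1 z) * (\<integral>\<^sup>+x\<in>Q2. ?\<sigma> z x \<partial>Leb d)"
      by (simp add: mult_ac)
  qed
  also have "\<dots> = (\<integral>\<^sup>+z. (w z * indicator Q1 z) * (ennreal (1 - (1 - s) * a / V2) * ennreal V2) \<partial>Leb d)"
    using inner by (intro nn_integral_cong) (auto simp: indicator_def)
  also have "\<dots> = (\<integral>\<^sup>+z\<in>Q1. w z \<partial>Leb d) * (ennreal (1 - (1 - s) * a / V2) * ennreal V2)"
    using w(1) sets(1) by (intro nn_integral_multc) auto
  finally have "(\<integral>\<^sup>+x\<in>Q2. ?F x \<partial>Leb d) \<le> (ennreal (1 - (1 - s) * a / V2) * (\<integral>\<^sup>+z\<in>Q1. w z \<partial>Leb d)) * emeasure (Leb d) Q2"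
    using V2 by (simp add: vol_def mult_ac)
  from exists_le_average[OF F sets(2) _ _ _ this] V2 w(2) show ?thesis
    by (auto simp: vol_def ennreal_mult_eq_top_iff)
qed

text \<open>Method of conditional expectations: each new translate weights the points it covers by
  \<open>s\<close>, and \<open>averaging_step\<close> places it so that the integral shrinks by at
  least the factor that a uniformly random centre in \<open>Q2\<close> would give on
  average.\<close>

lemma greedy_translates:
  fixes s a V1 V2 :: real and N :: nat
  assumes sets: "Q1 \<in> sets (Leb d)" "Q2 \<in> sets (Leb d)" "A \<in> sets (Leb d)"
    and V1: "vol d Q1 = ennreal V1" "V1 \<ge> 0"
    and V2: "vol d Q2 = ennreal V2" "V2 > 0" and a: "vol d A = ennreal a" "a \<ge> 0"
    and s: "0 \<le> s" "s \<le> 1"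
    and cov: "\<forall>z\<in>Q1. \<forall>x\<in>Rd d. diff d z x \<in> A \<longrightarrow> x \<in> Q2"
  shows "\<exists>x :: nat \<Rightarrow> nat \<Rightarrow> real. (\<forall>i. x i \<in> Q2) \<and>
     (\<integral>\<^sup>+z\<in>Q1. (\<Prod>i<N. if diff d z (x i) \<in> A then ennreal s else 1) \<partial>Leb d)
        \<le> ennreal (exp (- (1 - s) * a / V2 * N) * V1)"
proof (induction N)
  case 0
  have "Q2 \<noteq> {}" using V2 by (auto simp: vol_def)
  then obtain q where "q \<in> Q2" by auto
  then show ?case using V1 sets by (intro exI[of _ "\<lambda>_. q"]) (simp add: vol_def)
next
  case (Suc N)
  then obtain x where x: "\<And>i. x i \<in> Q2"
    and le: "(\<integral>\<^sup>+z\<in>Q1. (\<Prod>i<N. if diff d z (x i) \<in> A then ennreal s else 1) \<partial>Leb d)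
        \<le> ennreal (exp (- (1 - s) * a / V2 * N) * V1)" by blast
  let ?w = "\<lambda>z. \<Prod>i<N. if diff d z (x i) \<in> A then ennreal s else 1"
  have w: "?w \<in> borel_measurable (Leb d)"
  proof (intro borel_measurable_prod_ennreal measurable_If borel_measurable_const)
    fix i
    have "{z \<in> space (Leb d). diff d z (x i) \<in> A} = {z \<in> Rd d. diff d z (x i) \<in> A}" by (simp add: space_Leb)
    then show "{z \<in> space (Leb d). diff d z (x i) \<in> A} \<in> sets (Leb d)" using vol_shift(2)[OF sets(3)] by simp
  qed
  have fin: "(\<integral>\<^sup>+z\<in>Q1. ?w z \<partial>Leb d) \<noteq> \<infinity>" using le by (auto simp: top_unique)
  obtain q where q: "q \<in> Q2" and
    step: "(\<integral>\<^sup>+z\<in>Q1. ?w z * (if diff d z q \<in> A then ennreal s else 1) \<partial>Leb d)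
           \<le> ennreal (1 - (1 - s) * a / V2) * (\<integral>\<^sup>+z\<in>Q1. ?w z \<partial>Leb d)"
    using averaging_step[OF sets V2 a s cov w fin] by blast
  let ?x = "x(N := q)"
  have "(\<integral>\<^sup>+z\<in>Q1. (\<Prod>i<Suc N. if diff d z (?x i) \<in> A then ennreal s else 1) \<partial>Leb d)
      = (\<integral>\<^sup>+z\<in>Q1. ?w z * (if diff d z q \<in> A then ennreal s else 1) \<partial>Leb d)"
    by (simp add: lessThan_Suc mult.commute)
  also note step
  also have "ennreal (1 - (1 - s) * a / V2) * (\<integral>\<^sup>+z\<in>Q1. ?w z \<partial>Leb d)
      \<le> ennreal (exp (- (1 - s) * a / V2)) * ennreal (exp (- (1 - s) * a / V2 * N) * V1)"
  proof (intro mult_mono le)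
    \<comment> \<open>Uses \<open>1 + t \<le> exp t\<close>. A negative left side is harmless, since
      \<open>ennreal\<close> sends it to 0.\<close>
    show "ennreal (1 - (1 - s) * a / V2) \<le> ennreal (exp (- (1 - s) * a / V2))"
      using exp_ge_add_one_self[of "- (1 - s) * a / V2"] by (intro ennreal_leI) (simp del: exp_ge_add_one_self add: algebra_simps diff_divide_distrib)
  qed auto
  also have "\<dots> = ennreal (exp (- (1 - s) * a / V2 * Suc N) * V1)"
  proof -
    have "- (1 - s) * a / V2 * Suc N = - (1 - s) * a / V2 + - (1 - s) * a / V2 * N"
      by (simp add: distrib_left)
    then have "exp (- (1 - s) * a / V2 * Suc N) * V1 = exp (- (1 - s) * a / V2) * (exp (- (1 - s) * a / V2 * N) * V1)"
      by (simp only: exp_add mult.assoc)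
    then show ?thesis using V1 by (simp only: ennreal_mult mult_nonneg_nonneg exp_ge_zero)
  qed
  finally show ?case using x q by (intro exI[of _ ?x]) (auto simp: fun_upd_def)
qed

text \<open>Markov's inequality: the product in \<open>greedy_translates\<close> equals
  \<open>s\<close> to the power of the multiplicity at \<open>z\<close>, so it is at least
  \<open>s ^ f\<close> wherever fewer than \<open>f\<close> translates cover
  \<open>z\<close>.\<close>

lemma greedy_translates_few_bad_points:
  fixes s a V1 V2 :: real and N :: nat
  assumes sets: "Q1 \<in> sets (Leb d)" "Q2 \<in> sets (Leb d)" "A \<in> sets (Leb d)"
    and V1: "vol d Q1 = ennreal V1" "V1 \<ge> 0"
    and V2: "vol d Q2 = ennreal V2" "V2 > 0" and a: "vol d A = ennreal a" "a \<ge> 0"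
    and s: "0 < s" "s \<le> 1"
    and cov: "\<forall>z\<in>Q1. \<forall>x\<in>Rd d. diff d z x \<in> A \<longrightarrow> x \<in> Q2"
  shows "\<exists>(x :: nat \<Rightarrow> nat \<Rightarrow> real) B. (\<forall>i. x i \<in> Q2) \<and> B \<in> sets (Leb d) \<and>
     B = {z \<in> Q1. card {i\<in>{..<N}. diff d z (x i) \<in> A} < f} \<and>
     vol d B \<le> ennreal (exp (- (1 - s) * a / V2 * N) * V1 / s ^ f)"
proof -
  obtain x :: "nat \<Rightarrow> nat \<Rightarrow> real" where x: "\<And>i. x i \<in> Q2"
    and le: "(\<integral>\<^sup>+z\<in>Q1. (\<Prod>i<N. if diff d z (x i) \<in> A then ennreal s else 1) \<partial>Leb d)
        \<le> ennreal (exp (- (1 - s) * a / V2 * N) * V1)"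
    using greedy_translates[OF sets V1 V2 a less_imp_le[OF s(1)] s(2) cov] by blast
  let ?c = "\<lambda>z. card {i\<in>{..<N}. diff d z (x i) \<in> A}"
  let ?B = "{z \<in> Q1. ?c z < f}"
  have c: "?c z = card ({..<N} \<inter> {i. diff d z (x i) \<in> A})" for z
    by (rule arg_cong[of _ _ card]) auto
  have Q1: "Q1 \<subseteq> Rd d" using sets.sets_into_space[OF sets(1)] by (simp add: space_Leb)
  \<comment> \<open>Writing the multiplicity as a sum of indicators shows that the set is
    measurable.\<close>
  have "?B = Q1 \<inter> {z \<in> space (Leb d). (\<Sum>i<N. indicator {z \<in> Rd d. diff d z (x i) \<in> A} z :: real) < f}"
  proof -
    have "(\<Sum>i<N. indicator {z \<in> Rd d. diff d z (x i) \<in> A} z :: real) = ?c z" if "z \<in> Rd d" for z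
      using that unfolding c by (simp add: indicator_def sum.If_cases)
    then show ?thesis using Q1 by (auto simp: space_Leb)
  qed
  also have "\<dots> \<in> sets (Leb d)"
    using sets(1) vol_shift(2)[OF sets(3)] by (intro sets.Int borel_measurable_less borel_measurable_sum) auto
  finally have B: "?B \<in> sets (Leb d)" .
  have "ennreal (s ^ f) * vol d ?B = (\<integral>\<^sup>+z. ennreal (s ^ f) * indicator ?B z \<partial>Leb d)"
    unfolding vol_def by (rule nn_integral_cmult_indicator[OF B, symmetric])
  also have "\<dots> \<le> (\<integral>\<^sup>+z\<in>Q1. (\<Prod>i<N. if diff d z (x i) \<in> A then ennreal s else 1) \<partial>Leb d)"
  proof (intro nn_integral_mono)
    fix z
    have "(\<Prod>i<N. if diff d z (x i) \<in> A then ennreal s else 1) = ennreal (s ^ ?c z)"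
      using s unfolding c by (simp add: prod.If_cases ennreal_power)
    moreover have "s ^ f \<le> s ^ ?c z" if "?c z < f" using that s by (intro power_decreasing) auto
    ultimately show "ennreal (s ^ f) * indicator ?B z
        \<le> (\<Prod>i<N. if diff d z (x i) \<in> A then ennreal s else 1) * indicator Q1 z"
      by (auto simp: indicator_def intro!: ennreal_leI)
  qed
  also note le
  finally have "ennreal (1 / s ^ f) * (ennreal (s ^ f) * vol d ?B) \<le> ennreal (1 / s ^ f) * ennreal (exp (- (1 - s) * a / V2 * N) * V1)"
    by (intro mult_left_mono) auto
  also have "ennreal (1 / s ^ f) * (ennreal (s ^ f) * vol d ?B) = vol d ?B"
    using s by (simp add: mult.assoc[symmetric] ennreal_mult[symmetric])
  also have "ennreal (1 / s ^ f) * ennreal (exp (- (1 - s) * a / V2 * N) * V1) = ennreal (exp (- (1 - s) * a / V2 * N) * V1 / s ^ f)"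
    using s V1 by (simp add: ennreal_mult[symmetric])
  finally show ?thesis using x B by blast
qed

section \<open>Large symmetric pieces of a convex body\<close>

text \<open>
  The set \<open>L = K \<inter> (w - K)\<close> satisfies \<open>L - L \<subseteq> 2 K - w\<close>, so a difference body that appears in a
  packing argument fits into a translate of a dilate of \<open>K\<close>, at the cost of only \<open>2\<^bsup>d\<^esup>\<close> in volume.
\<close>

lemma large_self_reflection:
  assumes K: "K \<in> sets (Leb d)" "Rd_convex d K" and V: "vol d K = ennreal V" "V > 0"
  shows "\<exists>w. ennreal (V / 2 ^ d) \<le> vol d {y \<in> K. diff d w y \<in> K}"
proof -
  interpret L: sigma_finite_measure "Leb d" by (rule sigma_finite_Leb)
  interpret LL: pair_sigma_finite "Leb d" "Leb d" ..
  have KR: "K \<subseteq> Rd d" using sets.sets_into_space[OF K(1)] by (simp add: space_Leb)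
  \<comment> \<open>\<open>?K2\<close> is \<open>2 K\<close>. By convexity,
    \<open>K \<inter> (w - K)\<close> is empty unless \<open>w / 2 \<in> K\<close>, and its volume
    integrates over \<open>w\<close> to \<open>V * V\<close>; the mean over a set of volume
    \<open>2 ^ d * V\<close> is thus \<open>V / 2 ^ d\<close>.\<close>
  let ?K2 = "{w \<in> Rd d. (\<lambda>i\<in>{..<d}. (1/2) * w i + 0) \<in> K}"
  have K2: "?K2 \<in> sets (Leb d)" by (rule sets_affine_preimage[OF K(1)])
  have "ennreal (2 ^ d) * (ennreal ((1/2) ^ d) * vol d ?K2) = ennreal (2 ^ d) * ennreal V"
    using vol_affine_preimage[of "1/2" K d "\<lambda>_. 0"] K(1) V by simp
  moreover have "(2::real) ^ d * (1/2) ^ d = 1" by (simp flip: power_mult_distrib)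
  ultimately have vK2: "vol d ?K2 = ennreal (2 ^ d * V)"
    using V by (simp add: mult.assoc[symmetric] ennreal_mult[symmetric])
  let ?G = "\<lambda>p. indicator K (fst p) * indicator K (diff d (snd p) (fst p)) :: ennreal"
  have G: "?G \<in> borel_measurable (Leb d \<Otimes>\<^sub>M Leb d)"
    using measurable_diff_pair[of d] K by (intro borel_measurable_times_ennreal)
      (auto intro: measurable_compose[OF measurable_fst] measurable_compose[where N="Leb d"])
  let ?S = "\<lambda>w. {y \<in> K. diff d w y \<in> K}"
  have S: "?S w \<in> sets (Leb d)" for w
  proof -
    have "?S w = K \<inter> {y \<in> Rd d. diff d w y \<in> K}" using KR by auto
    then show ?thesis using K vol_reflect(2)[OF K(1)] by auto
  qed
  let ?F = "\<lambda>w. \<integral>\<^sup>+y. ?G (y, w) \<partial>Leb d"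
  have F_eq: "?F w = vol d (?S w)" for w
  proof -
    have "?F w = (\<integral>\<^sup>+y. indicator (?S w) y \<partial>Leb d)" by (intro nn_integral_cong) (auto simp: indicator_def)
    then show ?thesis using S by (simp add: vol_def)
  qed
  have F: "?F \<in> borel_measurable (Leb d)"
    using L.borel_measurable_nn_integral_fst[OF measurable_compose[OF measurable_pair_swap' G]] by simp
  have zero: "?G (y, w) = 0" if "w \<in> Rd d" "w \<notin> ?K2" for y w
  proof (rule ccontr)
    assume "?G (y, w) \<noteq> 0"
    then have y: "y \<in> K" "diff d w y \<in> K" by (auto simp: indicator_def split: if_splits)
    have "(\<lambda>i\<in>{..<d}. (1/2) * y i + (1/2) * diff d w y i) \<in> K"
      by (rule K(2)[unfolded Rd_convex_def, rule_format]) (use y in auto)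
    moreover have "(\<lambda>i\<in>{..<d}. (1/2) * y i + (1/2) * diff d w y i) = (\<lambda>i\<in>{..<d}. (1/2) * w i + 0)"
      by (auto simp: diff_def fun_eq_iff field_simps)
    ultimately show False using that by auto
  qed
  have "?F w * indicator ?K2 w = ?F w" if "w \<in> space (Leb d)" for w
  proof (cases "w \<in> ?K2")
    case False
    then have "?F w = (\<integral>\<^sup>+y. 0 \<partial>Leb d)"
      using zero[of w] that unfolding space_Leb by (intro nn_integral_cong) blast
    then show ?thesis using False by simp
  qed simp
  then have "(\<integral>\<^sup>+w\<in>?K2. ?F w \<partial>Leb d) = (\<integral>\<^sup>+w. ?F w \<partial>Leb d)"
    by (intro nn_integral_cong)
  also have "\<dots> = (\<integral>\<^sup>+y. \<integral>\<^sup>+w. ?G (y, w) \<partial>Leb d \<partial>Leb d)"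
    using G by (intro LL.Fubini') (auto simp: case_prod_beta)
  also have "\<dots> = (\<integral>\<^sup>+y. indicator K y * ennreal V \<partial>Leb d)"
  proof (intro nn_integral_cong)
    fix y assume "y \<in> space (Leb d)"
    have "(\<integral>\<^sup>+w. ?G (y, w) \<partial>Leb d) = (\<integral>\<^sup>+w. indicator K y * indicator {w \<in> Rd d. diff d w y \<in> K} w \<partial>Leb d)"
      by (intro nn_integral_cong) (auto simp: indicator_def space_Leb)
    also have "\<dots> = indicator K y * ennreal V"
      using vol_shift[OF K(1), of y] V by (subst nn_integral_cmult_indicator) (auto simp: vol_def)
    finally show "(\<integral>\<^sup>+w. ?G (y, w) \<partial>Leb d) = indicator K y * ennreal V" .
  qed
  also have "\<dots> = ennreal V * ennreal V"
    using K V by (simp add: nn_integral_multc vol_def)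
  finally have int: "(\<integral>\<^sup>+w\<in>?K2. ?F w \<partial>Leb d) = ennreal V * ennreal V" .
  have "\<exists>w\<in>?K2. ennreal (V / 2 ^ d) \<le> ?F w"
  proof (rule exists_ge_average[OF F K2])
    show "emeasure (Leb d) ?K2 \<noteq> 0" using vK2 V by (simp add: vol_def)
    show "(\<integral>\<^sup>+w\<in>?K2. ?F w \<partial>Leb d) \<noteq> \<infinity>" unfolding int by (simp add: ennreal_mult_eq_top_iff)
    show "ennreal (V / 2 ^ d) * emeasure (Leb d) ?K2 \<le> (\<integral>\<^sup>+w\<in>?K2. ?F w \<partial>Leb d)"
      unfolding int using vK2 V by (simp add: vol_def ennreal_mult[symmetric])
  qed
  then show ?thesis unfolding F_eq by blast
qed

subsection \<open>Periodic arrangements\<close>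

lemma bij_betw_restrict_pred:
  assumes "bij_betw g I J"
  shows "bij_betw g {i\<in>I. P (g i)} {j\<in>J. P j}"
  using assms by (auto simp: bij_betw_def inj_on_def)

text \<open>With its companion for coverage, this lets the periodic arrangement be indexed by pairs
  and moved to \<open>nat\<close> only at the end.\<close>

lemma arrangement_density_reindex:
  assumes "bij_betw g I J"
  shows "arrangement_density d K I (\<lambda>i. x (g i)) = arrangement_density d K J x"
  unfolding arrangement_density_def
  by (subst infsum_reindex_bij_betw[OF bij_betw_restrict_pred[OF assms], where f="\<lambda>j. vol d (translate d K (x j))"]) (rule refl)

lemma covered_at_least_reindex:
  assumes "bij_betw g I J"
  shows "covered_at_least d K I (\<lambda>i. x (g i)) f p \<longleftrightarrow> covered_at_least d K J x f p"
  using bij_betw_finite[OF bij_betw_restrict_pred[OF assms, of "\<lambda>j. p \<in> translate d K (x j)"]]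
    bij_betw_same_card[OF bij_betw_restrict_pred[OF assms, of "\<lambda>j. p \<in> translate d K (x j)"]]
  unfolding covered_at_least_def by simp

lemma vol_translate:
  assumes "K \<in> sets (Leb d)"
  shows "vol d (translate d K v) = vol d K"
proof -
  have "K \<subseteq> Rd d" using sets.sets_into_space[OF assms] by (simp add: space_Leb)
  then show ?thesis using vol_shift(1)[OF assms] by (simp add: translate_eq)
qed

text \<open>Shifting the finite family by all vectors of \<open>2 R Z^d\<close> turns coverage of
  one period cell into coverage of the whole space. A large cube of half side \<open>r\<close> meets
  at most about \<open>card F * (r / R) ^ d\<close> of the copies, hence the bound on the
  density.\<close>

lemma periodic_extension:
  fixes F :: "'j set" and x :: "'j \<Rightarrow> nat \<Rightarrow> real"
  assumes F: "finite F" and K: "K \<subseteq> cube d \<rho>" "K \<in> sets (Leb d)" and V: "vol d K = ennreal V" "V \<ge> 0"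
    and R: "R > 0"
    and cov: "\<And>p. p \<in> cube d R \<Longrightarrow> f \<le> card {j\<in>F. p \<in> translate d K (x j)}"
    and D: "real (card F) * V \<le> (2 * R) ^ d * D"
  shows "\<exists>(I :: nat set) (y :: nat \<Rightarrow> nat \<Rightarrow> real). (\<forall>i\<in>I. y i \<in> Rd d) \<and>
          arrangement_density d K I y \<le> ennreal D \<and> (\<forall>p\<in>Rd d. covered_at_least d K I y f p)"
proof -
  define J where "J = F \<times> (\<Pi>\<^sub>E i\<in>{..<d}. UNIV :: int set)"
  define X where "X = (\<lambda>(j, m). \<lambda>i\<in>{..<d}. x j i + 2 * R * real_of_int (m i))"
  have KR: "K \<subseteq> Rd d" using K(1) by (auto simp: cube_def Rd_def)
  have cJ: "countable J" unfolding J_def using F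
    by (intro countable_SIGMA countable_PiE) (auto simp: countable_finite)
  obtain b where b: "\<And>j i. j \<in> F \<Longrightarrow> i < d \<Longrightarrow> \<bar>x j i\<bar> \<le> b" "b \<ge> 0"
  proof
    fix j i assume "j \<in> F" "i < d"
    then show "\<bar>x j i\<bar> \<le> (\<Sum>p\<in>F \<times> {..<d}. \<bar>x (fst p) (snd p)\<bar>)"
      using F member_le_sum[of "(j, i)" "F \<times> {..<d}" "\<lambda>p. \<bar>x (fst p) (snd p)\<bar>"] by auto
  qed (auto intro: sum_nonneg)
  \<comment> \<open>Points of the translates indexed by \<open>F\<close> have coordinates of
    absolute value at most \<open>c\<close>, so a shift by \<open>2 * R * m\<close> can meet
    \<open>cube d r\<close> only if each \<open>2 * R * \<bar>m i\<bar>\<close> is at most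
    \<open>r + c\<close>.\<close>
  define c where "c = b + \<bar>\<rho>\<bar>"
  define S where "S r = {\<iota>\<in>J. translate d K (X \<iota>) \<inter> cube d r \<noteq> {}}" for r
  have S: "finite (S r) \<and> real (card (S r)) \<le> real (card F) * ((r + c) / R + 1) ^ d" if r: "r > 0" for r
  proof -
    define k where "k = \<lfloor>(r + c) / (2 * R)\<rfloor>"
    have pos: "(r + c) / (2 * R) \<ge> 0" using r R b(2) by (simp add: c_def)
    have sub: "S r \<subseteq> F \<times> (\<Pi>\<^sub>E i\<in>{..<d}. {-k..k})"
    proof
      fix \<iota> assume "\<iota> \<in> S r"
      then obtain j m z where jm: "\<iota> = (j, m)" "j \<in> F" "m \<in> (\<Pi>\<^sub>E i\<in>{..<d}. UNIV)"
        and z: "z \<in> translate d K (X (j, m))" "z \<in> cube d r"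
        by (auto simp: S_def J_def)
      from z(1) obtain y where y: "y \<in> K" "z = (\<lambda>i\<in>{..<d}. y i + X (j, m) i)" by (auto simp: translate_def)
      have "m i \<in> {-k..k}" if i: "i < d" for i
      proof -
        have "z i = y i + x j i + 2 * R * m i" using y(2) i by (simp add: X_def)
        moreover have "\<bar>z i\<bar> \<le> r" using z(2) i by (simp add: mem_cube_iff)
        moreover have "\<bar>y i\<bar> \<le> \<bar>\<rho>\<bar>" using y(1) K(1) i by (fastforce simp: mem_cube_iff)
        moreover have "\<bar>x j i\<bar> \<le> b" using b jm i by auto
        ultimately have "\<bar>2 * R * m i\<bar> \<le> r + c" unfolding c_def by linarith
        then have "2 * R * \<bar>m i\<bar> \<le> r + c" using R by (simp add: abs_mult)
        then have "\<bar>m i\<bar> \<le> (r + c) / (2 * R)" using R by (simp add: field_simps)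
        then have "\<bar>m i\<bar> \<le> k" unfolding k_def by (simp add: le_floor_iff)
        then show ?thesis by auto
      qed
      then show "\<iota> \<in> F \<times> (\<Pi>\<^sub>E i\<in>{..<d}. {-k..k})" using jm by (auto simp: PiE_iff)
    qed
    have fin: "finite (F \<times> (\<Pi>\<^sub>E i\<in>{..<d}. {-k..k}))" using F by (intro finite_cartesian_product finite_PiE) auto
    have "card (S r) \<le> card (F \<times> (\<Pi>\<^sub>E i\<in>{..<d}. {-k..k}))" by (rule card_mono[OF fin sub])
    also have "\<dots> = card F * nat (2 * k + 1) ^ d" by (simp add: card_cartesian_product card_PiE)
    finally have "real (card (S r)) \<le> real (card F) * real (nat (2 * k + 1)) ^ d"
      by (metis of_nat_le_iff of_nat_mult of_nat_power)
    also have "\<dots> \<le> real (card F) * ((r + c) / R + 1) ^ d"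
    proof (intro mult_left_mono power_mono)
      have k0: "k \<ge> 0" using pos by (simp add: k_def)
      have "real_of_int k \<le> (r + c) / (2 * R)" unfolding k_def by simp
      then show "real (nat (2 * k + 1)) \<le> (r + c) / R + 1" using k0 R by (simp add: field_simps)
    qed auto
    finally show ?thesis using finite_subset[OF sub fin] by blast
  qed
  \<comment> \<open>The boundary contributions, \<open>c\<close> and the summand 1, vanish as
    \<open>r\<close> grows.\<close>
  have lim: "((\<lambda>r. real (card F) * V * (((r + c) / R + 1) / (2 * r)) ^ d) \<longlongrightarrow> real (card F) * V * (1 / (2 * R)) ^ d) at_top"
  proof (intro tendsto_mult tendsto_const tendsto_power)
    have "((\<lambda>r. 1 / (2 * R) + (c / R + 1) / 2 * inverse r) \<longlongrightarrow> 1 / (2 * R) + (c / R + 1) / 2 * 0) at_top"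
      by (intro tendsto_intros tendsto_inverse_0_at_top filterlim_ident)
    moreover have "\<forall>\<^sub>F r in at_top. 1 / (2 * R) + (c / R + 1) / 2 * inverse r = ((r + c) / R + 1) / (2 * r)"
      using eventually_gt_at_top[of "0::real"] by eventually_elim (use R in \<open>simp add: field_simps\<close>)
    ultimately show "((\<lambda>r. ((r + c) / R + 1) / (2 * r)) \<longlongrightarrow> 1 / (2 * R)) at_top"
      using Lim_transform_eventually by fastforce
  qed
  have "arrangement_density d K J X \<le> Limsup at_top (\<lambda>r. ennreal (real (card F) * V * (((r + c) / R + 1) / (2 * r)) ^ d))"
    unfolding arrangement_density_def S_def[symmetric]
  proof (intro Limsup_mono eventually_mono[OF eventually_gt_at_top[of 0]])
    fix r :: real assume r: "r > 0"
    have "(\<Sum>\<^sub>\<infinity>\<iota>\<in>S r. vol d (translate d K (X \<iota>))) = ennreal (real (card (S r)) * V)"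
      using S[OF r] V by (simp add: vol_translate[OF K(2)] ennreal_mult ennreal_of_nat_eq_real_of_nat)
    also have "\<dots> \<le> ennreal (real (card F) * ((r + c) / R + 1) ^ d * V)"
      using S[OF r] V by (intro ennreal_leI mult_right_mono) auto
    finally have "(\<Sum>\<^sub>\<infinity>\<iota>\<in>S r. vol d (translate d K (X \<iota>))) / vol d (cube d r)
        \<le> ennreal (real (card F) * ((r + c) / R + 1) ^ d * V) / ennreal ((2 * r) ^ d)"
      using r by (simp add: vol_cube divide_right_mono_ennreal)
    also have "\<dots> = ennreal (real (card F) * ((r + c) / R + 1) ^ d * V / (2 * r) ^ d)"
      using r V R b(2) by (intro divide_ennreal) (auto simp: c_def)
    also have "real (card F) * ((r + c) / R + 1) ^ d * V / (2 * r) ^ d = real (card F) * V * (((r + c) / R + 1) / (2 * r)) ^ d"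
      by (simp add: power_divide)
    finally show "(\<Sum>\<^sub>\<infinity>\<iota>\<in>S r. vol d (translate d K (X \<iota>))) / vol d (cube d r)
        \<le> ennreal (real (card F) * V * (((r + c) / R + 1) / (2 * r)) ^ d)" .
  qed
  also have "\<dots> = ennreal (real (card F) * V * (1 / (2 * R)) ^ d)"
    by (intro lim_imp_Limsup tendsto_ennrealI lim) simp
  also have "\<dots> \<le> ennreal D"
    using D R by (intro ennreal_leI) (simp add: power_divide field_simps)
  finally have dens: "arrangement_density d K J X \<le> ennreal D" .
  have covJ: "covered_at_least d K J X f p" if p: "p \<in> Rd d" for p
  proof -
    \<comment> \<open>Rounding to the nearest lattice vector moves \<open>p\<close> to a point
      \<open>q\<close> of the period cell; pairing every \<open>j\<close> with this \<open>m\<close>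
      keeps the multiplicity.\<close>
    define m where "m = (\<lambda>i\<in>{..<d}. round (p i / (2 * R)))"
    define q where "q = (\<lambda>i\<in>{..<d}. p i - 2 * R * m i)"
    have "\<bar>q i\<bar> \<le> R" if i: "i < d" for i
    proof -
      have "\<bar>m i - p i / (2 * R)\<bar> \<le> 1/2" using of_int_round_abs_le[of "p i / (2 * R)"] i by (simp add: m_def)
      then have "2 * R * \<bar>m i - p i / (2 * R)\<bar> \<le> R" using R by (simp add: field_simps)
      then have "\<bar>2 * R * (m i - p i / (2 * R))\<bar> \<le> R" using R by (simp add: abs_mult)
      moreover have "2 * R * (m i - p i / (2 * R)) = - q i" using R i by (simp add: q_def field_simps)
      ultimately show ?thesis by simp
    qed
    then have "q \<in> cube d R" by (simp add: mem_cube_iff) (simp add: q_def Rd_def)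
    from cov[OF this] have f: "f \<le> card {j\<in>F. q \<in> translate d K (x j)}" .
    have "diff d p (X (j, m)) = diff d q (x j)" for j by (auto simp: diff_def q_def X_def fun_eq_iff)
    then have eq: "p \<in> translate d K (X (j, m)) \<longleftrightarrow> q \<in> translate d K (x j)" for j
      using p KR by (simp add: translate_eq) (simp add: q_def Rd_def)
    have "m \<in> (\<Pi>\<^sub>E i\<in>{..<d}. UNIV)" by (simp add: m_def)
    then have mJ: "(j, m) \<in> J \<longleftrightarrow> j \<in> F" for j by (simp add: J_def)
    have "card {j\<in>F. q \<in> translate d K (x j)} \<le> card {\<iota>\<in>J. p \<in> translate d K (X \<iota>)}"
      if "finite {\<iota>\<in>J. p \<in> translate d K (X \<iota>)}"
      using that eq by (intro card_inj_on_le[where f="\<lambda>j. (j, m)"]) (auto simp: inj_on_def mJ)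
    then show ?thesis unfolding covered_at_least_def using f by auto
  qed
  \<comment> \<open>The index set is an image rather than all of \<open>nat\<close> because
    \<open>J\<close> can be finite, for instance when \<open>d = 0\<close>.\<close>
  let ?I = "to_nat_on J ` J" and ?g = "from_nat_into J"
  have bij: "bij_betw ?g ?I J"
    by (rule bij_betw_byWitness[where f'="to_nat_on J"]) (auto simp: cJ)
  show ?thesis
  proof (intro exI[of _ ?I] exI[of _ "\<lambda>i. X (?g i)"] conjI ballI)
    show "X (?g i) \<in> Rd d" for i by (auto simp: X_def Rd_def split: prod.split)
    show "arrangement_density d K ?I (\<lambda>i. X (?g i)) \<le> ennreal D"
      using dens by (simp only: arrangement_density_reindex[OF bij])
    show "covered_at_least d K ?I (\<lambda>i. X (?g i)) f p" if "p \<in> Rd d" for p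
      using covJ[OF that] by (simp only: covered_at_least_reindex[OF bij])
  qed
qed

subsection \<open>Covering a large cube\<close>

lemma mem_translate_iff:
  assumes "K \<subseteq> Rd d"
  shows "p \<in> translate d K v \<longleftrightarrow> p \<in> Rd d \<and> (\<exists>y\<in>K. \<forall>i<d. p i = y i + v i)"
proof -
  have diff_apply: "diff d p v i = p i - v i" if "i < d" for i using that by (simp add: diff_def)
  have "diff d p v = y" if "y \<in> K" "\<forall>i<d. p i = y i + v i" for y
    using that assms by (auto simp: diff_def Rd_def PiE_iff extensional_def fun_eq_iff)
  then show ?thesis
    unfolding translate_eq[OF assms] by (metis (mono_tags, lifting) diff_apply diff_add_cancel mem_Collect_eq)
qed

text \<open>Take a largest disjoint family of sets \<open>p - \<delta> L\<close> with
  \<open>p - \<delta> K \<subseteq> B\<close>. They lie in \<open>B\<close> and have volume at least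
  \<open>(\<delta> / 2) ^ d * V\<close>, which bounds their number. For any such \<open>p\<close>,
  the set \<open>p - \<delta> L\<close> meets some \<open>q - \<delta> L\<close> of the family, so
  \<open>p - q \<in> \<delta> (L - L) \<subseteq> \<delta> (2 K - w)\<close>, and
  \<open>2 * \<delta> \<le> 1\<close> lets this fit into a translate of \<open>K\<close>.\<close>

lemma packing_cover:
  assumes K: "K \<in> sets (Leb d)" "Rd_convex d K" and V: "vol d K = ennreal V" "V > 0"
    and B: "B \<in> sets (Leb d)" "vol d B \<le> ennreal \<beta>" "\<beta> \<ge> 0" and \<delta>: "0 < \<delta>" "\<delta> \<le> 1/2"
  shows "\<exists>T. finite T \<and> real (card T) * V \<le> \<beta> * (2 / \<delta>) ^ d \<and>
    (\<forall>p\<in>Rd d. (\<forall>k\<in>K. (\<lambda>i\<in>{..<d}. p i - \<delta> * k i) \<in> B) \<longrightarrow> (\<exists>t\<in>T. p \<in> translate d K t))"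
proof -
  have KR: "K \<subseteq> Rd d" using sets.sets_into_space[OF K(1)] by (simp add: space_Leb)
  obtain w where w: "ennreal (V / 2 ^ d) \<le> vol d {y \<in> K. diff d w y \<in> K}"
    using large_self_reflection[OF K V] by blast
  define L where "L = {y \<in> K. diff d w y \<in> K}"
  have "L = K \<inter> {y \<in> Rd d. diff d w y \<in> K}" using KR by (auto simp: L_def)
  then have L: "L \<in> sets (Leb d)" using K(1) vol_reflect(2)[OF K(1), of w] by auto
  have "vol d L > 0" using w V unfolding L_def by (intro less_le_trans[OF _ w]) simp
  then have "L \<noteq> {}" by (auto simp: vol_def)
  then obtain k0 where k0: "k0 \<in> L" by auto
  \<comment> \<open>This is \<open>p - \<delta> L\<close>, written as a preimage so that
    \<open>vol_affine_preimage\<close> gives its volume.\<close>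
  define S where "S p = {z \<in> Rd d. (\<lambda>i\<in>{..<d}. (-1/\<delta>) * z i + p i / \<delta>) \<in> L}" for p
  have S: "S p \<in> sets (Leb d)" for p unfolding S_def by (rule sets_affine_preimage[OF L])
  have volS: "ennreal (\<delta> ^ d * (V / 2 ^ d)) \<le> vol d (S p)" for p
  proof -
    have "ennreal (\<delta> ^ d * (V / 2 ^ d)) = ennreal (\<delta> ^ d) * ennreal (V / 2 ^ d)"
      using \<delta> V by (intro ennreal_mult) auto
    also have "\<dots> \<le> ennreal (\<delta> ^ d) * vol d L" using w by (auto simp: L_def intro: mult_left_mono)
    also have "\<dots> = ennreal (\<delta> ^ d) * (ennreal (\<bar>-1/\<delta>\<bar> ^ d) * vol d (S p))"
      unfolding S_def using \<delta> by (subst vol_affine_preimage[OF _ L]) auto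
    also have "\<dots> = ennreal (\<delta> ^ d * \<bar>-1/\<delta>\<bar> ^ d) * vol d (S p)"
      using \<delta> by (simp add: ennreal_mult mult.assoc)
    also have "\<delta> ^ d * \<bar>-1/\<delta>\<bar> ^ d = 1" using \<delta> by (simp flip: power_mult_distrib)
    finally show ?thesis by simp
  qed
  have memS: "(\<lambda>i\<in>{..<d}. p i - \<delta> * l i) \<in> S p" if "l \<in> L" for p l
  proof -
    have "(\<lambda>i\<in>{..<d}. (-1/\<delta>) * (\<lambda>i\<in>{..<d}. p i - \<delta> * l i) i + p i / \<delta>) = l"
      using that KR \<delta> by (auto simp: L_def fun_eq_iff Rd_def PiE_iff extensional_def field_simps subset_iff)
    then show ?thesis using that by (simp add: S_def) (simp add: Rd_def)
  qed
  have S_cases: "\<exists>l\<in>L. \<forall>i<d. z i = p i - \<delta> * l i" if z: "z \<in> S p" for z p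
  proof (intro bexI allI impI)
    show "(\<lambda>i\<in>{..<d}. (-1/\<delta>) * z i + p i / \<delta>) \<in> L" using z by (simp add: S_def)
    show "z i = p i - \<delta> * (\<lambda>i\<in>{..<d}. (-1/\<delta>) * z i + p i / \<delta>) i" if "i < d" for i
      using that \<delta> by (simp add: field_simps)
  qed
  define D where "D = {p \<in> Rd d. \<forall>k\<in>K. (\<lambda>i\<in>{..<d}. p i - \<delta> * k i) \<in> B}"
  have SB: "S p \<subseteq> B" if "p \<in> D" for p
  proof
    fix z assume z: "z \<in> S p"
    then obtain l where l: "l \<in> L" "\<forall>i<d. z i = p i - \<delta> * l i" using S_cases by blast
    have "z = (\<lambda>i\<in>{..<d}. p i - \<delta> * l i)"
      using l(2) z by (auto simp: S_def Rd_def PiE_iff extensional_def fun_eq_iff)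
    then show "z \<in> B" using that l(1) by (auto simp: D_def L_def)
  qed
  define good where "good T \<longleftrightarrow> finite T \<and> T \<subseteq> D \<and> disjoint_family_on S T" for T
  have bound: "real (card T) * V \<le> \<beta> * (2 / \<delta>) ^ d" if "good T" for T
  proof -
    have "ennreal (real (card T) * (\<delta> ^ d * (V / 2 ^ d))) = (\<Sum>p\<in>T. ennreal (\<delta> ^ d * (V / 2 ^ d)))"
      using \<delta> V by (simp add: ennreal_of_nat_eq_real_of_nat del: times_divide_eq_right flip: ennreal_mult)
    also have "\<dots> \<le> (\<Sum>p\<in>T. vol d (S p))" using volS by (intro sum_mono)
    also have "\<dots> = vol d (\<Union>p\<in>T. S p)"
      unfolding vol_def using that S by (intro sum_emeasure) (auto simp: good_def)
    also have "\<dots> \<le> vol d B" unfolding vol_def using that SB B by (intro emeasure_mono) (auto simp: good_def)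
    also note B(2)
    finally have "real (card T) * (\<delta> ^ d * (V / 2 ^ d)) \<le> \<beta>" using B(3) by simp
    then show ?thesis using \<delta> by (simp add: field_simps power_divide)
  qed
  \<comment> \<open>The volume bound caps the size of good families, so one of largest cardinality
    exists.\<close>
  have "\<exists>T. good T \<and> (\<forall>T'. good T' \<longrightarrow> card T' \<le> card T)"
  proof (rule ex_has_greatest_nat)
    show "good {}" by (simp add: good_def disjoint_family_on_def)
    show "\<forall>T. good T \<longrightarrow> card T < Suc (nat \<lceil>\<beta> * (2 / \<delta>) ^ d / V\<rceil>)"
    proof (intro allI impI)
      fix T assume "good T"
      then have "real (card T) \<le> \<beta> * (2 / \<delta>) ^ d / V" using bound[of T] V by (simp add: pos_le_divide_eq)
      then show "card T < Suc (nat \<lceil>\<beta> * (2 / \<delta>) ^ d / V\<rceil>)" by linarith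
    qed
  qed
  then obtain T where T: "good T" and max: "\<And>T'. good T' \<Longrightarrow> card T' \<le> card T" by blast
  \<comment> \<open>If \<open>p - \<delta> l = q - \<delta> l'\<close> with \<open>l' = w - k\<close>, then \<open>p = q - \<delta> w + 2 \<delta> (l + k) / 2\<close>; the multiple of \<open>k0\<close>
    turns \<open>2 \<delta> (l + k) / 2\<close> into a convex combination of points of \<open>K\<close>.\<close>
  define t where "t q = (\<lambda>i. q i - \<delta> * w i - (1 - 2 * \<delta>) * k0 i)" for q :: "nat \<Rightarrow> real"
  have "\<exists>q\<in>T. p \<in> translate d K (t q)" if p: "p \<in> D" for p
  proof -
    have "\<exists>q\<in>T. S p \<inter> S q \<noteq> {}"
    proof (rule ccontr)
      assume "\<not> ?thesis"
      then have dis: "\<And>q. q \<in> T \<Longrightarrow> S p \<inter> S q = {}" by auto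
      \<comment> \<open>\<open>S p\<close> is nonempty because of \<open>k0\<close>, so
        \<open>p \<in> T\<close> would make it disjoint from itself.\<close>
      then have "p \<notin> T" using memS[OF k0] by blast
      moreover have "good (insert p T)"
        using T p dis unfolding good_def disjoint_family_on_def by (auto simp: Int_commute)
      ultimately show False using max[of "insert p T"] T by (simp add: good_def)
    qed
    then obtain q z where q: "q \<in> T" "z \<in> S p" "z \<in> S q" by auto
    obtain l where l: "l \<in> L" "\<forall>i<d. z i = p i - \<delta> * l i" using S_cases[OF q(2)] by blast
    obtain l' where l': "l' \<in> L" "\<forall>i<d. z i = q i - \<delta> * l' i" using S_cases[OF q(3)] by blast
    have inK: "l \<in> K" "diff d w l' \<in> K" "k0 \<in> K" using l l' k0 by (auto simp: L_def)
    define m where "m = (\<lambda>i\<in>{..<d}. (1/2) * l i + (1/2) * diff d w l' i)"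
    have m: "m \<in> K" unfolding m_def by (rule K(2)[unfolded Rd_convex_def, rule_format]) (use inK in auto)
    let ?y = "\<lambda>i\<in>{..<d}. (2 * \<delta>) * m i + (1 - 2 * \<delta>) * k0 i"
    have y: "?y \<in> K" by (rule K(2)[unfolded Rd_convex_def, rule_format]) (use m inK \<delta> in auto)
    have "p i = ?y i + t q i" if "i < d" for i
    proof -
      have "p i - \<delta> * l i = q i - \<delta> * l' i" using l l' that by simp
      then show ?thesis using that by (simp add: m_def t_def diff_def algebra_simps diff_divide_distrib)
    qed
    then show ?thesis using p q(1) y unfolding mem_translate_iff[OF KR] D_def by blast
  qed
  moreover have "real (card (t ` T)) * V \<le> \<beta> * (2 / \<delta>) ^ d"
  proof -
    have "real (card (t ` T)) * V \<le> real (card T) * V"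
      using T V by (intro mult_right_mono) (auto simp: good_def intro!: card_image_le)
    then show ?thesis using bound[OF T] by linarith
  qed
  ultimately show ?thesis using T by (intro exI[of _ "t ` T"]) (auto simp: good_def D_def)
qed

text \<open>The summands of the bound come from the greedy translates, where
  \<open>(1 / (1 - \<delta>)) ^ d\<close> pays for shrinking \<open>K\<close>; from rounding up
  their number; and from \<open>f\<close> copies of a covering of the remaining points. The factors
  \<open>1 + \<theta>\<close> absorb the boundary of the cube.\<close>

lemma finite_cover:
  fixes c \<delta> \<theta> \<kappa> M \<rho> V :: real
  assumes d: "d \<ge> 1"
    and K: "K \<in> sets (Leb d)" "Rd_convex d K" "K \<subseteq> cube d \<rho>" and V: "vol d K = ennreal V" "V > 0"
    and M: "real f \<le> M" and \<delta>: "0 < \<delta>" "\<delta> \<le> 1/2" and c: "c > 1" "\<kappa> \<le> c - 1 - ln c" and \<theta>: "\<theta> > 0"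
    and \<rho>: "\<rho> > 0"
  shows "\<exists>R>0. \<exists>(F :: (nat + (nat \<Rightarrow> real) \<times> nat) set) x. finite F \<and>
    (\<forall>p\<in>cube d R. f \<le> card {j\<in>F. p \<in> translate d K (x j)}) \<and>
    real (card F) * V \<le> (2 * R) ^ d *
      (c * M * (1 / (1 - \<delta>)) ^ d * (1 + \<theta>) + \<theta> + M * (2 / \<delta>) ^ d * exp (- \<kappa> * M) * (1 + \<theta>))"
proof -
  have KR: "K \<subseteq> Rd d" using sets.sets_into_space[OF K(1)] by (simp add: space_Leb)
  have M0: "M \<ge> 0" using M by linarith
  \<comment> \<open>For large \<open>R\<close>, enlarging the cube by \<open>2 * \<rho>\<close>
    costs a factor \<open>1 + \<theta>\<close>, and one extra copy of \<open>K\<close> costs density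
    \<open>\<theta>\<close>.\<close>
  have "\<forall>\<^sub>F R in at_top. (2 * (R + 2 * \<rho>)) ^ d \<le> (1 + \<theta>) * (2 * R) ^ d \<and> V \<le> \<theta> * (2 * R) ^ d \<and> R > 0"
  proof (intro eventually_conj eventually_gt_at_top)
    have "((\<lambda>R. (1 + 2 * \<rho> * inverse R) ^ d) \<longlongrightarrow> (1 + 2 * \<rho> * 0) ^ d) at_top"
      by (intro tendsto_intros tendsto_inverse_0_at_top filterlim_ident)
    then have "\<forall>\<^sub>F R in at_top. (1 + 2 * \<rho> * inverse R) ^ d < 1 + \<theta>"
      using \<theta> by (intro order_tendstoD) auto
    then show "\<forall>\<^sub>F R in at_top. (2 * (R + 2 * \<rho>)) ^ d \<le> (1 + \<theta>) * (2 * R) ^ d"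
      using eventually_gt_at_top[of 0]
    proof eventually_elim
      case (elim R)
      have "(2 * (R + 2 * \<rho>)) ^ d = (1 + 2 * \<rho> * inverse R) ^ d * (2 * R) ^ d"
      proof -
        have "2 * (R + 2 * \<rho>) = (1 + 2 * \<rho> * inverse R) * (2 * R)" using elim by (simp add: field_simps)
        then show ?thesis by (simp only: power_mult_distrib)
      qed
      then show ?case using elim by (simp add: mult_right_mono)
    qed
    have "filterlim (\<lambda>R. (2 * R) ^ d :: real) at_top at_top"
      using d by (intro filterlim_pow_at_top filterlim_tendsto_pos_mult_at_top[OF tendsto_const] filterlim_ident) auto
    then have "\<forall>\<^sub>F R in at_top. V / \<theta> \<le> (2 * R) ^ d" by (simp add: filterlim_at_top)
    then show "\<forall>\<^sub>F R in at_top. V \<le> \<theta> * (2 * R) ^ d"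
      by (rule eventually_mono) (use \<theta> in \<open>simp add: pos_divide_le_eq mult.commute\<close>)
  qed
  then obtain R where R: "(2 * (R + 2 * \<rho>)) ^ d \<le> (1 + \<theta>) * (2 * R) ^ d" "V \<le> \<theta> * (2 * R) ^ d" "R > 0"
    using eventually_happens'[OF trivial_limit_at_top_linorder] by blast
  \<comment> \<open>The margins ensure that \<open>?Q1\<close> contains
    \<open>p - \<delta> K\<close> for all \<open>p\<close> in \<open>cube d R\<close>, and that
    \<open>?Q2\<close> contains every centre whose copy of \<open>(1 - \<delta>) K\<close> reaches
    \<open>?Q1\<close>.\<close>
  let ?Q1 = "cube d (R + \<rho>)" and ?Q2 = "cube d (R + 2 * \<rho>)"
  define V1 V2 where "V1 = (2 * (R + \<rho>)) ^ d" and "V2 = (2 * (R + 2 * \<rho>)) ^ d"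
  have V1: "vol d ?Q1 = ennreal V1" "V1 \<ge> 0" using R \<rho> by (auto simp: V1_def vol_cube)
  have V2: "vol d ?Q2 = ennreal V2" "V2 > 0" using R \<rho> by (auto simp: V2_def vol_cube)
  have V12: "V1 \<le> V2" using R \<rho> unfolding V1_def V2_def by (intro power_mono) auto
  define A where "A = {z \<in> Rd d. (\<lambda>i\<in>{..<d}. (1 / (1 - \<delta>)) * z i + 0) \<in> K}"
  define a where "a = (1 - \<delta>) ^ d * V"
  have A: "A \<in> sets (Leb d)" unfolding A_def by (rule sets_affine_preimage[OF K(1)])
  have a: "vol d A = ennreal a" "a > 0"
  proof -
    have "ennreal ((1 - \<delta>) ^ d) * (ennreal (\<bar>1 / (1 - \<delta>)\<bar> ^ d) * vol d A) = ennreal ((1 - \<delta>) ^ d) * ennreal V"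
      unfolding A_def using \<delta> V by (subst vol_affine_preimage[OF _ K(1)]) auto
    moreover have "(1 - \<delta>) ^ d * \<bar>1 / (1 - \<delta>)\<bar> ^ d = 1" using \<delta> by (simp flip: power_mult_distrib)
    ultimately show "vol d A = ennreal a" using \<delta> V
      by (simp add: a_def mult.assoc[symmetric] ennreal_mult[symmetric])
    show "a > 0" using \<delta> V by (simp add: a_def)
  qed
  have A_cases: "\<exists>k\<in>K. \<forall>i<d. z i = (1 - \<delta>) * k i" if "z \<in> A" for z
    using that \<delta> by (intro bexI[of _ "\<lambda>i\<in>{..<d}. (1 / (1 - \<delta>)) * z i + 0"]) (auto simp: A_def)
  have K\<rho>: "\<bar>k i\<bar> \<le> \<rho>" if "k \<in> K" "i < d" for k i using that K(3) by (fastforce simp: mem_cube_iff)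
  have cov: "\<forall>z\<in>?Q1. \<forall>x\<in>Rd d. diff d z x \<in> A \<longrightarrow> x \<in> ?Q2"
  proof (intro ballI impI)
    fix z x assume z: "z \<in> ?Q1" and x: "x \<in> Rd d" and zx: "diff d z x \<in> A"
    obtain k where k: "k \<in> K" "\<forall>i<d. diff d z x i = (1 - \<delta>) * k i" using A_cases[OF zx] by blast
    have "\<bar>x i\<bar> \<le> R + 2 * \<rho>" if i: "i < d" for i
    proof -
      have "\<bar>(1 - \<delta>) * k i\<bar> \<le> 1 * \<rho>" unfolding abs_mult using \<delta> K\<rho>[OF k(1) i] by (intro mult_mono) auto
      moreover have "\<bar>z i\<bar> \<le> R + \<rho>" using z i by (simp add: mem_cube_iff)
      moreover have "z i - x i = (1 - \<delta>) * k i" using k(2) i by (simp add: diff_def)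
      ultimately show ?thesis by linarith
    qed
    then show "x \<in> ?Q2" using x by (simp add: mem_cube_iff)
  qed
  \<comment> \<open>So many copies of \<open>A\<close> have total volume at least
    \<open>c * M\<close> times that of \<open>?Q2\<close>.\<close>
  define N where "N = nat \<lceil>c * M * V2 / a\<rceil>"
  have cMV: "c * M * V2 / a \<ge> 0" using c M0 V2 a by simp
  have N: "c * M * V2 / a \<le> real N" "real N \<le> c * M * V2 / a + 1"
    using cMV unfolding N_def by linarith+
  \<comment> \<open>The weight \<open>s = 1 / c\<close> minimises
    \<open>exp (- (1 - s) * c * M) / s powr M\<close>; the minimum is
    \<open>exp (- (c - 1 - ln c) * M)\<close>.\<close>
  have c': "0 < 1 / c" "1 / c \<le> 1" using c by auto
  obtain x B where B: "B \<in> sets (Leb d)" "B = {z \<in> ?Q1. card {i\<in>{..<N}. diff d z (x i) \<in> A} < f}"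
    and volB: "vol d B \<le> ennreal (exp (- (1 - 1 / c) * a / V2 * N) * V1 / (1 / c) ^ f)"
    using greedy_translates_few_bad_points[OF sets_cube sets_cube A V1 V2 a(1) less_imp_le[OF a(2)] c' cov, of N f] by blast
  define \<beta> where "\<beta> = exp (- \<kappa> * M) * V1"
  have "exp (- (1 - 1 / c) * a / V2 * N) * V1 / (1 / c) ^ f \<le> \<beta>"
  proof -
    have "(1 - 1 / c) * (c * M) \<le> (1 - 1 / c) * (a / V2 * N)"
    proof (intro mult_left_mono)
      show "c * M \<le> a / V2 * N" using N(1) a V2 by (simp add: field_simps)
    qed (use c in auto)
    moreover have "(1 - 1 / c) * (c * M) = (c - 1) * M" using c by (simp add: field_simps)
    moreover have "- u * a / V2 * N = - (u * (a / V2 * N))" for u :: real by simp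
    ultimately have "- (1 - 1 / c) * a / V2 * N \<le> - ((c - 1) * M)" by (metis neg_le_iff_le)
    then have e: "exp (- (1 - 1 / c) * a / V2 * N) \<le> exp (- ((c - 1) * M))" by simp
    have "c ^ f = exp (ln c * f)" using c by (simp add: exp_of_nat_mult mult.commute flip: powr_realpow)
    also have "\<dots> \<le> exp (ln c * M)" using M c by (simp add: mult_left_mono)
    finally have "exp (- (1 - 1 / c) * a / V2 * N) * c ^ f \<le> exp (- ((c - 1) * M)) * exp (ln c * M)"
      using c by (intro mult_mono e) auto
    also have "\<dots> = exp (- ((c - 1 - ln c) * M))" by (simp add: algebra_simps flip: exp_add)
    also have "\<dots> \<le> exp (- \<kappa> * M)" using c M0 by (simp add: mult_right_mono)
    finally have "exp (- (1 - 1 / c) * a / V2 * N) * c ^ f * V1 \<le> exp (- \<kappa> * M) * V1"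
      using V1(2) by (intro mult_right_mono)
    then show ?thesis by (simp only: \<beta>_def divide_inverse power_inverse inverse_inverse_eq mult_1_left mult.assoc mult.commute[of V1])
  qed
  then have vB: "vol d B \<le> ennreal \<beta>" using volB ennreal_leI order_trans by blast
  have \<beta>: "\<beta> \<ge> 0" using V1 by (simp add: \<beta>_def)
  obtain T where T: "finite T" "real (card T) * V \<le> \<beta> * (2 / \<delta>) ^ d"
    and Tcov: "\<forall>p\<in>Rd d. (\<forall>k\<in>K. (\<lambda>i\<in>{..<d}. p i - \<delta> * k i) \<in> B) \<longrightarrow> (\<exists>t\<in>T. p \<in> translate d K t)"
    using packing_cover[OF K(1,2) V B(1) vB \<beta> \<delta>] by blast
  \<comment> \<open>The right summand repeats each packing translate \<open>f\<close> times, so that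
    a single one containing \<open>p\<close> suffices.\<close>
  define F where "F = {..<N} <+> (T \<times> {..<f})"
  define X where "X = (case_sum x fst :: nat + (nat \<Rightarrow> real) \<times> nat \<Rightarrow> nat \<Rightarrow> real)"
  have finF: "finite F" using T by (simp add: F_def)
  have covF: "f \<le> card {j\<in>F. p \<in> translate d K (X j)}" if p: "p \<in> cube d R" for p
  proof -
    have pR: "p \<in> Rd d" using p by (simp add: mem_cube_iff)
    show ?thesis
    proof (cases "\<forall>k\<in>K. (\<lambda>i\<in>{..<d}. p i - \<delta> * k i) \<in> B")
      case True
      then obtain t where t: "t \<in> T" "p \<in> translate d K t" using Tcov pR by blast
      have "card {..<f} \<le> card {j\<in>F. p \<in> translate d K (X j)}"
        using t finF by (intro card_inj_on_le[where f="\<lambda>i. Inr (t, i)"]) (auto simp: inj_on_def F_def X_def)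
      then show ?thesis by simp
    next
      case False
      then obtain k where k: "k \<in> K" "(\<lambda>i\<in>{..<d}. p i - \<delta> * k i) \<notin> B" by blast
      let ?z = "\<lambda>i\<in>{..<d}. p i - \<delta> * k i"
      have "\<bar>p i - \<delta> * k i\<bar> \<le> R + \<rho>" if i: "i < d" for i
      proof -
        have "\<bar>\<delta> * k i\<bar> \<le> 1 * \<rho>" unfolding abs_mult using \<delta> K\<rho>[OF k(1) i] by (intro mult_mono) auto
        moreover have "\<bar>p i\<bar> \<le> R" using p i by (simp add: mem_cube_iff)
        ultimately show ?thesis by linarith
      qed
      then have "?z \<in> ?Q1" by (simp add: mem_cube_iff) (simp add: Rd_def)
      then have f: "f \<le> card {i\<in>{..<N}. diff d ?z (x i) \<in> A}" using k(2) unfolding B(2) by auto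
      \<comment> \<open>Here \<open>p = z + \<delta> k\<close> and \<open>z - x i\<close> lies in
        \<open>(1 - \<delta>) K\<close>, so \<open>p - x i\<close> is a convex combination of two
        points of \<open>K\<close>.\<close>
      have "p \<in> translate d K (x i)" if zA: "diff d ?z (x i) \<in> A" for i
      proof -
        obtain k' where k': "k' \<in> K" "\<forall>j<d. diff d ?z (x i) j = (1 - \<delta>) * k' j" using A_cases[OF zA] by blast
        have y: "(\<lambda>j\<in>{..<d}. (1 - \<delta>) * k' j + \<delta> * k j) \<in> K"
          by (rule K(2)[unfolded Rd_convex_def, rule_format]) (use k k' \<delta> in auto)
        have "p j = (\<lambda>j\<in>{..<d}. (1 - \<delta>) * k' j + \<delta> * k j) j + x i j" if "j < d" for j
          using k'(2) that by (auto simp: diff_def algebra_simps)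
        then show ?thesis using pR y unfolding mem_translate_iff[OF KR] by blast
      qed
      then have "card {i\<in>{..<N}. diff d ?z (x i) \<in> A} \<le> card {j\<in>F. p \<in> translate d K (X j)}"
        using finF by (intro card_inj_on_le[where f=Inl]) (auto simp: F_def X_def)
      then show ?thesis using f by linarith
    qed
  qed
  have "real (card F) * V = real N * V + real (card T) * V * f"
    using T by (simp add: F_def card_Plus card_cartesian_product algebra_simps)
  also have "real N * V \<le> c * M * (1 / (1 - \<delta>)) ^ d * V2 + V"
  proof -
    have "real N * V \<le> (c * M * V2 / a + 1) * V" using N(2) V by (intro mult_right_mono) auto
    also have "\<dots> = c * M * (1 / (1 - \<delta>)) ^ d * V2 + V"
      using V \<delta> unfolding a_def by (simp add: field_simps power_divide)
    finally show ?thesis .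
  qed
  also have "real (card T) * V * f \<le> M * (2 / \<delta>) ^ d * exp (- \<kappa> * M) * V2"
  proof -
    have "real (card T) * V * f \<le> (\<beta> * (2 / \<delta>) ^ d) * M"
      by (rule mult_mono[OF T(2) M]) (use \<beta> \<delta> in auto)
    also have "\<dots> = M * (2 / \<delta>) ^ d * exp (- \<kappa> * M) * V1" by (simp add: \<beta>_def)
    also have "\<dots> \<le> M * (2 / \<delta>) ^ d * exp (- \<kappa> * M) * V2" using V12 M0 \<delta> by (intro mult_left_mono) auto
    finally show ?thesis .
  qed
  also have "c * M * (1 / (1 - \<delta>)) ^ d * V2 + V + M * (2 / \<delta>) ^ d * exp (- \<kappa> * M) * V2
     \<le> c * M * (1 / (1 - \<delta>)) ^ d * ((1 + \<theta>) * (2 * R) ^ d) + \<theta> * (2 * R) ^ d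
        + M * (2 / \<delta>) ^ d * exp (- \<kappa> * M) * ((1 + \<theta>) * (2 * R) ^ d)"
    using R c M0 \<delta> unfolding V2_def by (intro add_mono mult_left_mono) auto
  also have "\<dots> = (2 * R) ^ d *
      (c * M * (1 / (1 - \<delta>)) ^ d * (1 + \<theta>) + \<theta> + M * (2 / \<delta>) ^ d * exp (- \<kappa> * M) * (1 + \<theta>))"
    by (simp add: algebra_simps)
  finally have "real (card F) * V \<le> (2 * R) ^ d *
      (c * M * (1 / (1 - \<delta>)) ^ d * (1 + \<theta>) + \<theta> + M * (2 / \<delta>) ^ d * exp (- \<kappa> * M) * (1 + \<theta>))"
    by simp
  then show ?thesis using R(3) finF covF by blast
qed

subsection \<open>The error term\<close>

lemma ln_3153: "ln (3.153 :: real) \<le> 1.149"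
proof -
  \<comment> \<open>Splitting the exponent into 32 equal parts makes the quadratic Taylor bound
    sharp enough: \<open>1.03655 ^ 32\<close> is about 3.154.\<close>
  have "(1.03655 :: real) \<le> 1 + 1.149 / 32 + (1.149 / 32)\<^sup>2 / 2" by (simp add: power2_eq_square)
  also have "\<dots> \<le> exp (1.149 / 32)" by (rule exp_lower_Taylor_quadratic) simp
  finally have "1.03655 ^ 32 \<le> exp (1.149 / 32 :: real) ^ 32" by (rule power_mono) simp
  also have "\<dots> = exp 1.149" by (simp flip: exp_of_nat_mult)
  finally have "1.03655 ^ 32 \<le> exp (1.149 :: real)" .
  moreover have "(3.153 :: real) \<le> 1.03655 ^ 32" by (simp add: power_divide)
  ultimately have "(3.153 :: real) \<le> exp 1.149" by linarith
  then show ?thesis using ln_le_cancel_iff[of "3.153" "exp (1.149 :: real)"] by simp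
qed


text \<open>
  The constant \<open>1.004\<close> is a lower bound for \<open>3.153 - 1 - ln 3.153\<close>; what matters is that it exceeds 1,
  which lets the exponential beat \<open>(4 + 2 d ln d)\<^bsup>d\<^esup>\<close>.
\<close>

definition density_error :: "nat \<Rightarrow> real" where
  "density_error d = (1 / (1 - 1 / (2 + real d * ln (real d)))) ^ d * (1 + 1 / real d) + 1 / real d
      + (2 / (1 / (2 + real d * ln (real d)))) ^ d * exp (- 1.004 * (real d * ln (real d))) * (1 + 1 / real d) - 1"

text \<open>With \<open>L = d ln d\<close>, the first power tends to 1 because
  \<open>d / (2 + L)\<close> tends to 0. In the last term \<open>(4 + 2 L)^d\<close> is
  \<open>exp (d ln d + O(d ln ln d))\<close>, which \<open>exp (- 1.004 L)\<close>
  outweighs.\<close>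

lemma density_error_tendsto_0: "density_error \<longlonglongrightarrow> 0"
  unfolding density_error_def by real_asymp

theorem theorem1p4:
  "\<exists>\<eta> :: nat \<Rightarrow> real. \<eta> \<longlonglongrightarrow> 0 \<and>
     (\<forall>d\<ge>1. \<forall>K. convex_body d K \<longrightarrow> (\<forall>f\<ge>1.
        \<exists>(I :: nat set) (x :: nat \<Rightarrow> nat \<Rightarrow> real).
          (\<forall>i\<in>I. x i \<in> Rd d) \<and>
          arrangement_density d K I x
            \<le> ennreal ((1 + \<eta> d) * 3.153 * max (real d * ln (real d)) (real f)) \<and>
          (\<forall>p\<in>Rd d. covered_at_least d K I x f p)))"
proof (intro exI[of _ density_error] conjI density_error_tendsto_0 allI impI)
  fix d K f assume d: "(1::nat) \<le> d" and "convex_body d K" and f: "(1::nat) \<le> f"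
  then have cK: "compact K" "K \<subseteq> Rd d" and conv: "Rd_convex d K" and int: "Rd_topology d interior_of K \<noteq> {}"
    using compact_if_compactin_Rd by (auto simp: convex_body_def)
  have K: "K \<in> sets (Leb d)" by (rule compact_measurable[OF cK])
  obtain \<rho> where \<rho>: "\<rho> > 0" "K \<subseteq> cube d \<rho>" using compact_subset_cube[OF cK] by blast
  have "vol d K \<le> vol d (cube d \<rho>)" unfolding vol_def by (intro emeasure_mono \<rho> sets_cube)
  also have "\<dots> < \<infinity>" using \<rho>(1) by (simp add: vol_cube)
  finally have fin: "vol d K < \<infinity>" .
  define V where "V = enn2real (vol d K)"
  have V: "vol d K = ennreal V" "V > 0"
    using fin vol_pos_of_interior[OF int K] by (auto simp: V_def enn2real_positive_iff)
  define L where "L = real d * ln (real d)"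
  define M where "M = max L (real f)"
  have L: "L \<ge> 0" using d by (simp add: L_def)
  have M: "L \<le> M" "real f \<le> M" "1 \<le> M" using f by (auto simp: M_def le_max_iff_disj)
  \<comment> \<open>The summand 2 keeps this at most 1/2, also for \<open>d = 1\<close>, where
    \<open>L = 0\<close>.\<close>
  define \<delta> where "\<delta> = 1 / (2 + L)"
  have \<delta>: "0 < \<delta>" "\<delta> \<le> 1/2" using L by (auto simp: \<delta>_def field_simps)
  define \<theta> where "\<theta> = 1 / real d"
  have \<theta>: "\<theta> > 0" using d by (simp add: \<theta>_def)
  define A where "A = (1 / (1 - \<delta>)) ^ d"
  define G where "G = (2 / \<delta>) ^ d"
  have G: "G \<ge> 0" using \<delta> by (simp add: G_def)
  have "(1.004 :: real) \<le> 3.153 - 1 - ln 3.153" using ln_3153 by simp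
  then obtain R F x where R: "R > 0" and F: "finite (F :: (nat + (nat \<Rightarrow> real) \<times> nat) set)"
    and cov: "\<And>p. p \<in> cube d R \<Longrightarrow> f \<le> card {j\<in>F. p \<in> translate d K (x j)}"
    and card: "real (card F) * V \<le> (2 * R) ^ d *
      (3.153 * M * A * (1 + \<theta>) + \<theta> + M * G * exp (- 1.004 * M) * (1 + \<theta>))"
    using finite_cover[OF d K conv \<rho>(2) V M(2) \<delta> _ _ \<theta> \<rho>(1), of "3.153" "1.004"]
    unfolding A_def G_def by auto
  \<comment> \<open>The factor \<open>3.153 * M\<close> is extracted using \<open>1 \<le> M\<close>,
    and \<open>M\<close> in the exponential is lowered to \<open>L\<close>; this leaves an error
    that depends on \<open>d\<close> alone.\<close>
  have "3.153 * M * A * (1 + \<theta>) + \<theta> + M * G * exp (- 1.004 * M) * (1 + \<theta>)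
      \<le> 3.153 * M * A * (1 + \<theta>) + 3.153 * M * \<theta> + 3.153 * M * G * exp (- 1.004 * L) * (1 + \<theta>)"
  proof (intro add_mono order_refl)
    show "\<theta> \<le> 3.153 * M * \<theta>" using M \<theta> by simp
    show "M * G * exp (- 1.004 * M) * (1 + \<theta>) \<le> 3.153 * M * G * exp (- 1.004 * L) * (1 + \<theta>)"
      using M G \<theta> by (intro mult_mono) auto
  qed
  also have "\<dots> = (1 + density_error d) * 3.153 * M"
    unfolding density_error_def L_def[symmetric] \<delta>_def[symmetric] \<theta>_def[symmetric] A_def[symmetric] G_def[symmetric]
    by (simp add: algebra_simps add_divide_distrib)
  finally have "real (card F) * V \<le> (2 * R) ^ d * ((1 + density_error d) * 3.153 * M)"
    using R by (intro order_trans[OF card] mult_left_mono) auto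
  from periodic_extension[OF F \<rho>(2) K V(1) less_imp_le[OF V(2)] R cov this]
  show "\<exists>(I :: nat set) (x :: nat \<Rightarrow> nat \<Rightarrow> real).
          (\<forall>i\<in>I. x i \<in> Rd d) \<and>
          arrangement_density d K I x
            \<le> ennreal ((1 + density_error d) * 3.153 * max (real d * ln (real d)) (real f)) \<and>
          (\<forall>p\<in>Rd d. covered_at_least d K I x f p)"
    unfolding M_def L_def by blast
qed

end
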